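(* Let $k\ge1$ and let $\varphi^{k-1}\in\mathcal V^1(\mathcal T^{k-1})$, $\varphi^k\in\mathcal V^1(\mathcal T^k)$, $\mu^k\in\mathcal V^1(\mathcal T^k)$, $v^k\in H(\mathrm{div},\mathcal T^k)$ be given. Let $v_h^{k+1}\in H(\mathrm{div},\mathcal T^{k+1})$, $\varphi_h^{k+1},\mu_h^{k+1}\in\mathcal V^1(\mathcal T^{k+1})$ be a solution of the fully discrete system: for all $w\in H(\mathrm{div},\mathcal T^{k+1})$, $\Phi,\Psi\in\mathcal V^1(\mathcal T^{k+1})$, $$\tfrac1{2\tau}\big(\rho^kv_h^{k+1}-\rho^{k-1}v^k+\rho^{k-1}(v_h^{k+1}-v^k),w\big)+a(\rho^kv^k+J^k,v_h^{k+1},w)+(2\eta^kDv_h^{k+1},Dw)-(\mu_h^{k+1}\nabla\varphi^k+\rho^kg,w)=0,$$ $$\tfrac1\tau(\varphi_h^{k+1}-\mathcal P^{k+1}\varphi^k,\Phi)+(m(\varphi^k)\nabla\mu_h^{k+1},\nabla\Phi)+(v_h^{k+1}\cdot\nabla\varphi^k,\Phi)=0,$$ $$\sigma\epsilon(\nabla\varphi_h^{k+1},\nabla\Psi)+(F_+'(\varphi_h^{k+1})+F_-'(\mathcal P^{k+1}\varphi^k),\Psi)-(\mu_h^{k+1},\Psi)=0.$$ Then $$\begin{aligned}&\tfrac12\int_\Omega\rho^k|v_h^{k+1}|^2dx+\tfrac{\sigma\epsilon}2\int_\Omega|\nabla\varphi_h^{k+1}|^2dx+\int_\Omega F(\varphi_h^{k+1})dx\\&+\tfrac12\int_\Omega\rho^{k-1}|v_h^{k+1}-v^k|^2dx+\tfrac{\sigma\epsilon}2\int_\Omega|\nabla\varphi_h^{k+1}-\nabla\mathcal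 P^{k+1}\varphi^k|^2dx\\&+\tau\int_\Omega2\eta^k|Dv_h^{k+1}|^2dx+\tau\int_\Omega m^k|\nabla\mu_h^{k+1}|^2dx\\&\le\tfrac12\int_\Omega\rho^{k-1}|v^k|^2dx+\tfrac{\sigma\epsilon}2\int_\Omega|\nabla\mathcal P^{k+1}\varphi^k|^2dx+\int_\Omega F(\mathcal P^{k+1}\varphi^k)dx+\tau\int_\Omega\rho^kg\cdot v_h^{k+1}dx.\end{aligned}$$
   Context: $\Omega\subset\mathbb R^n$, $n\in\{2,3\}$, is a bounded domain; $(\cdot,\cdot)$ is the $L^2(\Omega)$ inner product (for scalar-, vector- or matrix-valued functions). $\sigma,\epsilon>0$ and the time step $\tau>0$ are constants, $g\in L^2(\Omega)^n$ is the given gravitational force, $Dv=\frac12(\nabla v+(\nabla v)^t)$. Meshes and spaces: for each time index $k$, $\mathcal T^k$ is a conforming triangulation of $\overline\Omega$ into closed simplices (meshes for different $k$ may differ). $\mathcal V^j(\mathcal T^k)$, $j=1,2$, is the space of continuous functions on $\overline\Omega$ that are polynomials of degree at most $j$ on each $T\in\mathcal T^k$. $L^2_{(0)}(\Omega)$ is the space of $L^2$ functions with zero mean. $H(\mathrm{div},\mathcal T^k)=\{v\in\mathcal V^2(\mathcal T^k)^n:\ (\mathrm{div}\,v,q)=0\ \forall q\in\mathcal V^1(\mathcal T^k)\cap L^2_{(0)}(\Omega),\ v|_{\partial\Omega}=0\}$. Projection: $\mathcal P^k:H^1(\Omega)\to\mathcal V^1(\mathcal T^k)$ is a fixed projection operator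 with $\|\mathcal P^kv\|_{L^p(\Omega)}\le\|v\|_{L^p(\Omega)}$ and $\|\nabla\mathcal P^kv\|_{L^r(\Omega)}\le\|\nabla v\|_{L^r(\Omega)}$ for $v\in H^1(\Omega)$, $r\in[1,2]$, and $p\in[1,6)$ if $n=3$, $p\in[1,\infty)$ if $n=2$. Trilinear form: $a(u,v,w)=\frac12\int_\Omega((u\cdot\nabla)v)\cdot w\,dx-\frac12\int_\Omega((u\cdot\nabla)w)\cdot v\,dx$. Notation: $\rho^k=\rho(\varphi^k)$, $\eta^k=\eta(\varphi^k)$, $m^k=m(\varphi^k)$, $J^k=-\rho'(\varphi^k)m^k\nabla\mu^k$. Standing assumptions on the data: $\rho,\eta,m:\mathbb R\to\mathbb R$ are continuous with $\overline\rho\ge\rho\ge\underline\rho>0$, $\overline\eta\ge\eta\ge\underline\eta>0$, $\overline m\ge m\ge\underline m>0$. Moreover $\rho$ is smooth and monotone; for constants $0<\tilde\rho_1\le\tilde\rho_2$ it equals $\frac{\tilde\rho_2-\tilde\rho_1}2\varphi+\frac{\tilde\rho_1+\tilde\rho_2}2$ for $|\varphi|<1+\frac{\tilde\rho_1}{\tilde\rho_2-\tilde\rho_1}$ and is constant on each of $\varphi>1+\frac{2\tilde\rho_1}{\tilde\rho_2-\tilde\rho_1}$ and $\varphi<-1-\frac{2\tilde\rho_1}{\tilde\rho_2-\tilde\rho_1}$ ($\rho$ constant if $\tilde\rho_1=\tilde\rho_2$). $F=F_++F_-:\mathbb R\to\mathbb R$ is continuously differentiable, $F_+$ convex, $F_-$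 concave (both differentiable). There are $C>0$ and $q\in[1,4]$ if $n=3$, $q\in[1,\infty)$ if $n=2$, with $|F(x)|\le C(1+|x|^q)$, $|F_\pm'(x)|\le C(1+|x|^{q-1})$. $F_+'$, viewed as an operator $H^1(\Omega)\to H^1(\Omega)^*$, is Newton (slantly) differentiable with Newton derivative $G$ satisfying $(G(\varphi)\delta\varphi,\delta\varphi)\ge0$ for all $\varphi,\delta\varphi\in H^1(\Omega)$. *)

theory Defs
  imports "HOL-Analysis.Analysis"
begin

text \<open>
  Functions on \<open>\<Omega>\<close> are represented by functions on the whole of \<open>real^'n\<close> whose values off the
  closure of \<open>\<Omega>\<close> are irrelevant: all integrals run over \<open>\<Omega>\<close>, and membership in the spaces below
  only looks at \<open>\<Omega>\<close>, or at its closure for continuous functions.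
\<close>

section \<open>Lebesgue and Sobolev spaces\<close>

definition L2 :: "(real^'n) set \<Rightarrow> (real^'n \<Rightarrow> 'b::euclidean_space) set" where
  "L2 \<Omega> = {f. f \<in> borel_measurable (lebesgue_on \<Omega>) \<and>
                integrable (lebesgue_on \<Omega>) (\<lambda>x. (norm (f x))\<^sup>2)}"

text \<open>The norm and inner product of matrices in \<open>real^'n^'n\<close> are the Frobenius ones.\<close>

definition L2_inner ::
  "(real^'n) set \<Rightarrow> (real^'n \<Rightarrow> 'b::euclidean_space) \<Rightarrow> (real^'n \<Rightarrow> 'b) \<Rightarrow> real" where
  "L2_inner \<Omega> f g = (\<integral>x. f x \<bullet> g x \<partial>lebesgue_on \<Omega>)"

definition L2_zero_mean :: "(real^'n) set \<Rightarrow> (real^'n \<Rightarrow> real) set" where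
  "L2_zero_mean \<Omega> = {f \<in> L2 \<Omega>. (\<integral>x. f x \<partial>lebesgue_on \<Omega>) = 0}"

text \<open>The Bochner integral of a non-integrable function is 0, so the infinite case is separate.\<close>

definition Lp_norm :: "real \<Rightarrow> (real^'n) set \<Rightarrow> (real^'n \<Rightarrow> 'b::euclidean_space) \<Rightarrow> ennreal" where
  "Lp_norm p \<Omega> f =
     (if integrable (lebesgue_on \<Omega>) (\<lambda>x. norm (f x) powr p)
      then ennreal ((\<integral>x. norm (f x) powr p \<partial>lebesgue_on \<Omega>) powr (1 / p))
      else \<infinity>)"

definition partial_deriv :: "'n \<Rightarrow> (real^'n \<Rightarrow> real) \<Rightarrow> real^'n \<Rightarrow> real" where
  "partial_deriv i f x = frechet_derivative f (at x) (axis i 1)"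

definition smooth :: "(real^'n \<Rightarrow> real) \<Rightarrow> bool" where
  "smooth f \<longleftrightarrow> (\<forall>is x. fold partial_deriv is f differentiable (at x))"

definition test_functions :: "(real^'n) set \<Rightarrow> (real^'n \<Rightarrow> real) set" where
  "test_functions \<Omega> =
     {\<psi>. smooth \<psi> \<and> compact (closure {x. \<psi> x \<noteq> 0}) \<and> closure {x. \<psi> x \<noteq> 0} \<subseteq> \<Omega>}"

definition has_weak_grad ::
  "(real^'n) set \<Rightarrow> (real^'n \<Rightarrow> real) \<Rightarrow> (real^'n \<Rightarrow> real^'n) \<Rightarrow> bool" where
  "has_weak_grad \<Omega> u G \<longleftrightarrow> u \<in> L2 \<Omega> \<and> G \<in> L2 \<Omega> \<and>
     (\<forall>\<psi>\<in>test_functions \<Omega>. \<forall>i.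
        (\<integral>x. u x * partial_deriv i \<psi> x \<partial>lebesgue_on \<Omega>) = - (\<integral>x. G x $ i * \<psi> x \<partial>lebesgue_on \<Omega>))"

definition H1 :: "(real^'n) set \<Rightarrow> (real^'n \<Rightarrow> real) set" where
  "H1 \<Omega> = {u. \<exists>G. has_weak_grad \<Omega> u G}"

text \<open>A representative of the weak gradient, which is unique almost everywhere on \<open>\<Omega>\<close>.\<close>

definition weak_grad :: "(real^'n) set \<Rightarrow> (real^'n \<Rightarrow> real) \<Rightarrow> real^'n \<Rightarrow> real^'n" where
  "weak_grad \<Omega> u = (SOME G. has_weak_grad \<Omega> u G)"

text \<open>Row \<open>i\<close> of the weak Jacobian is the gradient of the \<open>i\<close>-th component, so that
  \<open>(u \<cdot> \<nabla>) v\<close> is \<open>weak_jac \<Omega> v x *v u x\<close>.\<close>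

definition weak_jac :: "(real^'n) set \<Rightarrow> (real^'n \<Rightarrow> real^'n) \<Rightarrow> real^'n \<Rightarrow> real^'n^'n" where
  "weak_jac \<Omega> v x = (\<chi> i. weak_grad \<Omega> (\<lambda>y. v y $ i) x)"

definition sym_grad :: "(real^'n) set \<Rightarrow> (real^'n \<Rightarrow> real^'n) \<Rightarrow> real^'n \<Rightarrow> real^'n^'n" where
  "sym_grad \<Omega> v x = (1/2) *\<^sub>R (weak_jac \<Omega> v x + transpose (weak_jac \<Omega> v x))"

definition weak_div :: "(real^'n) set \<Rightarrow> (real^'n \<Rightarrow> real^'n) \<Rightarrow> real^'n \<Rightarrow> real" where
  "weak_div \<Omega> v x = (\<Sum>i\<in>UNIV. weak_jac \<Omega> v x $ i $ i)"

definition trilinear_form ::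
  "(real^'n) set \<Rightarrow> (real^'n \<Rightarrow> real^'n) \<Rightarrow> (real^'n \<Rightarrow> real^'n) \<Rightarrow> (real^'n \<Rightarrow> real^'n) \<Rightarrow> real" where
  "trilinear_form \<Omega> u v w =
     1/2 * (\<integral>x. (weak_jac \<Omega> v x *v u x) \<bullet> w x \<partial>lebesgue_on \<Omega>)
     - 1/2 * (\<integral>x. (weak_jac \<Omega> w x *v u x) \<bullet> v x \<partial>lebesgue_on \<Omega>)"

definition H1_norm :: "(real^'n) set \<Rightarrow> (real^'n \<Rightarrow> real) \<Rightarrow> real" where
  "H1_norm \<Omega> u = sqrt ((\<integral>x. (u x)\<^sup>2 \<partial>lebesgue_on \<Omega>) + (\<integral>x. (norm (weak_grad \<Omega> u x))\<^sup>2 \<partial>lebesgue_on \<Omega>))"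

text \<open>Elements of the dual are functionals on \<open>H1 \<Omega>\<close>; boundedness makes them independent of the
  choice of representatives.\<close>

definition H1_dual :: "(real^'n) set \<Rightarrow> ((real^'n \<Rightarrow> real) \<Rightarrow> real) set" where
  "H1_dual \<Omega> = {l.
     (\<forall>u\<in>H1 \<Omega>. \<forall>v\<in>H1 \<Omega>. \<forall>a b. l (\<lambda>x. a * u x + b * v x) = a * l u + b * l v) \<and>
     (\<exists>K. \<forall>u\<in>H1 \<Omega>. \<bar>l u\<bar> \<le> K * H1_norm \<Omega> u)}"

definition H1_dual_norm :: "(real^'n) set \<Rightarrow> ((real^'n \<Rightarrow> real) \<Rightarrow> real) \<Rightarrow> real" where
  "H1_dual_norm \<Omega> l = (SUP u\<in>{u \<in> H1 \<Omega>. H1_norm \<Omega> u \<le> 1}. \<bar>l u\<bar>)"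

text \<open>\<open>G \<phi>\<close> is a bounded linear operator from \<open>H1 \<Omega>\<close> to its dual, written as the bilinear form
  \<open>G \<phi> \<delta> \<psi>\<close>. As usual for Newton derivatives, it is evaluated at the perturbed point
  \<open>\<phi> + h\<close> in the remainder.\<close>

definition newton_derivative ::
  "(real^'n) set \<Rightarrow> ((real^'n \<Rightarrow> real) \<Rightarrow> (real^'n \<Rightarrow> real) \<Rightarrow> real) \<Rightarrow>
   ((real^'n \<Rightarrow> real) \<Rightarrow> (real^'n \<Rightarrow> real) \<Rightarrow> (real^'n \<Rightarrow> real) \<Rightarrow> real) \<Rightarrow> bool" where
  "newton_derivative \<Omega> A G \<longleftrightarrow>
     (\<forall>\<phi>\<in>H1 \<Omega>. A \<phi> \<in> H1_dual \<Omega>) \<and>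
     (\<forall>\<phi>\<in>H1 \<Omega>.
        (\<forall>\<delta>\<in>H1 \<Omega>. G \<phi> \<delta> \<in> H1_dual \<Omega>) \<and>
        (\<forall>\<delta>\<in>H1 \<Omega>. \<forall>\<delta>'\<in>H1 \<Omega>. \<forall>\<psi>\<in>H1 \<Omega>. \<forall>a b.
           G \<phi> (\<lambda>x. a * \<delta> x + b * \<delta>' x) \<psi> = a * G \<phi> \<delta> \<psi> + b * G \<phi> \<delta>' \<psi>) \<and>
        (\<exists>K. \<forall>\<delta>\<in>H1 \<Omega>. H1_dual_norm \<Omega> (G \<phi> \<delta>) \<le> K * H1_norm \<Omega> \<delta>)) \<and>
     (\<forall>\<phi>\<in>H1 \<Omega>. \<forall>\<phi>'\<in>H1 \<Omega>. (AE x in lebesgue_on \<Omega>. \<phi> x = \<phi>' x) \<longrightarrow>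
        (\<forall>\<delta>\<in>H1 \<Omega>. \<forall>\<psi>\<in>H1 \<Omega>. G \<phi> \<delta> \<psi> = G \<phi>' \<delta> \<psi>)) \<and>
     (\<forall>\<phi>\<in>H1 \<Omega>. \<forall>e>0. \<exists>d>0. \<forall>h\<in>H1 \<Omega>. H1_norm \<Omega> h < d \<longrightarrow>
        H1_dual_norm \<Omega> (\<lambda>\<psi>. A (\<lambda>x. \<phi> x + h x) \<psi> - A \<phi> \<psi> - G (\<lambda>x. \<phi> x + h x) h \<psi>)
          \<le> e * H1_norm \<Omega> h)"

section \<open>Finite element spaces\<close>

definition conforming_mesh :: "(real^'n) set \<Rightarrow> (real^'n) set set \<Rightarrow> bool" where
  "conforming_mesh \<Omega> \<T> \<longleftrightarrow>
     triangulation \<T> \<and> (\<forall>T\<in>\<T>. int CARD('n) simplex T) \<and> \<Union>\<T> = closure \<Omega>"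

text \<open>Polynomials of total degree at most \<open>j\<close>, with multi-indices \<open>\<alpha> :: 'n \<Rightarrow> nat\<close>.\<close>

definition polynomials_upto :: "nat \<Rightarrow> (real^'n \<Rightarrow> real) set" where
  "polynomials_upto j =
     {p. \<exists>c. \<forall>x. p x = (\<Sum>\<alpha> | (\<Sum>i\<in>UNIV. \<alpha> i) \<le> j. c \<alpha> * (\<Prod>i\<in>UNIV. x $ i ^ \<alpha> i))}"

lemma finite_multi_indices: "finite {\<alpha> :: 'n::finite \<Rightarrow> nat. (\<Sum>i\<in>UNIV. \<alpha> i) \<le> j}"
proof (rule finite_subset)
  have "\<alpha> i \<le> j" if "(\<Sum>i\<in>UNIV. \<alpha> i) \<le> j" for \<alpha> :: "'n \<Rightarrow> nat" and i
    using member_le_sum[of i UNIV \<alpha>] that by simp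
  then show "{\<alpha> :: 'n \<Rightarrow> nat. (\<Sum>i\<in>UNIV. \<alpha> i) \<le> j} \<subseteq> PiE UNIV (\<lambda>_. {..j})"
    by (simp add: subset_iff PiE_iff)
  show "finite (PiE (UNIV :: 'n set) (\<lambda>_. {..j}))"
    by (intro finite_PiE) simp_all
qed

definition fe_space :: "(real^'n) set \<Rightarrow> (real^'n) set set \<Rightarrow> nat \<Rightarrow> (real^'n \<Rightarrow> real) set" where
  "fe_space \<Omega> \<T> j =
     {u. continuous_on (closure \<Omega>) u \<and> (\<forall>T\<in>\<T>. \<exists>p\<in>polynomials_upto j. \<forall>x\<in>T. u x = p x)}"

definition Hdiv :: "(real^'n) set \<Rightarrow> (real^'n) set set \<Rightarrow> (real^'n \<Rightarrow> real^'n) set" where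
  "Hdiv \<Omega> \<T> =
     {v. (\<forall>i. (\<lambda>x. v x $ i) \<in> fe_space \<Omega> \<T> 2) \<and>
         (\<forall>q \<in> fe_space \<Omega> \<T> 1 \<inter> L2_zero_mean \<Omega>. L2_inner \<Omega> (weak_div \<Omega> v) q = 0) \<and>
         (\<forall>x\<in>frontier \<Omega>. v x = 0)}"

text \<open>\<open>P\<close> acts on equivalence classes of functions and is idempotent with range \<open>fe_space \<Omega> \<T> 1\<close>.
  Linearity is not imposed: a linear idempotent contraction for the \<open>L\<^sup>2\<close> norm would be the
  orthogonal \<open>L\<^sup>2\<close> projection, which is not a contraction for the \<open>L\<^sup>1\<close> norm.\<close>

definition stable_projection ::
  "(real^'n) set \<Rightarrow> (real^'n) set set \<Rightarrow> ((real^'n \<Rightarrow> real) \<Rightarrow> real^'n \<Rightarrow> real) \<Rightarrow> bool" where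
  "stable_projection \<Omega> \<T> P \<longleftrightarrow>
     (\<forall>v\<in>H1 \<Omega>. P v \<in> fe_space \<Omega> \<T> 1) \<and>
     (\<forall>v\<in>H1 \<Omega>. \<forall>v'\<in>H1 \<Omega>. (AE x in lebesgue_on \<Omega>. v x = v' x) \<longrightarrow>
        (\<forall>x\<in>closure \<Omega>. P v x = P v' x)) \<and>
     (\<forall>v\<in>fe_space \<Omega> \<T> 1. \<forall>x\<in>closure \<Omega>. P v x = v x) \<and>
     (\<forall>v\<in>H1 \<Omega>. \<forall>p\<ge>1. (CARD('n) = 3 \<longrightarrow> p < 6) \<longrightarrow> Lp_norm p \<Omega> (P v) \<le> Lp_norm p \<Omega> v) \<and>
     (\<forall>v\<in>H1 \<Omega>. \<forall>r\<in>{1..2}. Lp_norm r \<Omega> (weak_grad \<Omega> (P v)) \<le> Lp_norm r \<Omega> (weak_grad \<Omega> v))"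

end

theory Submission
  imports Defs
begin

text \<open>
  Testing the momentum equation with \<open>v_new\<close>, the phase equation with \<open>\<mu>_new\<close> and the potential
  equation with \<open>\<phi>_new - P \<phi>\<close>, the convective term vanishes by skew-symmetry and the coupling terms
  cancel in the sum. The quadratic terms are polarized, and \<open>F (\<phi>_new) - F (P \<phi>)\<close> is bounded by
  the derivative term because \<open>Fp\<close> is treated implicitly (tangent at \<open>\<phi>_new\<close>) and \<open>Fm\<close> explicitly
  (tangent at \<open>P \<phi>\<close>).

  Since \<open>weak_grad\<close> is a choice of a representative, this needs that finite element functions do have
  square integrable weak gradients, and that weak gradients are unique almost everywhere, which makes
  \<open>weak_grad\<close> additive.
\<close>

text \<open>Consecutive meshes differ, so \<open>\<phi>_new - \<phi>\<close> is in general not an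
  admissible test function; projecting \<open>\<phi>\<close> first makes the difference one, and
  this is why the energy of \<open>P (k + 1) \<phi>\<close> stands on the right. The other two
  equations are tested with unknowns, whose chosen gradients enter exactly as they stand. Only the
  gradient of the difference has to be compared with two other choices, and there equality almost
  everywhere suffices. Uniqueness rests on the fundamental lemma of the calculus of variations.
  Since \<open>smooth\<close> speaks of all iterated partial derivatives, the test functions that
  approximate indicators of boxes are built by hand, as products of factors exp (-1/t) in single
  coordinates. For existence, integrating by parts simplex by simplex would call for normals and for
  the cancellation of traces across faces. Working with the product of \<open>u\<close> and a test
  function on the whole space replaces this by a Lipschitz bound along coordinate lines.\<close>

section \<open>Smooth functions with explicit bumps\<close>

text \<open>The family is closed under differentiation, which is what makes \<open>flat\<close> smooth at 0.\<close>

definition flat :: "nat \<Rightarrow> real \<Rightarrow> real" where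
  "flat k t = (if t > 0 then exp (- (1 / t)) / t ^ k else 0)"

text \<open>From the right, s = 1/t turns the claim into s^k / exp s tending to 0 at infinity; from
  the left the function is constantly 0.\<close>

lemma flat_tendsto_0: "(flat k \<longlongrightarrow> 0) (at 0)"
proof -
  have "((\<lambda>t. inverse t ^ k / exp (inverse t)) \<longlongrightarrow> (0::real)) (at_right 0)"
    by (rule filterlim_compose[OF tendsto_power_div_exp_0 filterlim_inverse_at_top_right])
  moreover have "\<forall>\<^sub>F t in at_right 0. inverse t ^ k / exp (inverse t) = flat k t"
    by (auto simp: eventually_at_filter flat_def exp_minus field_simps)
  ultimately have "(flat k \<longlongrightarrow> 0) (at_right 0)"
    using tendsto_cong by fast
  moreover have "\<forall>\<^sub>F t in at_left 0. (0::real) = flat k t"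
    by (auto simp: eventually_at_filter flat_def)
  then have "(flat k \<longlongrightarrow> 0) (at_left 0)"
    using tendsto_cong tendsto_const by fast
  ultimately show ?thesis
    by (simp add: filterlim_split_at)
qed

lemma has_real_derivative_flat:
  "(flat k has_real_derivative (flat (k + 2) t - real k * flat (k + 1) t)) (at t)"
proof (cases t "0::real" rule: linorder_cases)
  case less
  have "((\<lambda>_. 0) has_real_derivative 0) (at t)" by simp
  then have "(flat k has_real_derivative 0) (at t)"
    by (rule has_field_derivative_transform_within_open[where S = "{..<0}"])
      (use less in \<open>auto simp: flat_def\<close>)
  then show ?thesis using less by (simp add: flat_def)
next
  case equal
  \<comment> \<open>At the origin the difference quotient of \<open>flat k\<close> is
    \<open>flat (k + 1)\<close> itself, so the derivative there is the limit 0 already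
    computed.\<close>
  have "\<forall>\<^sub>F h in at 0. flat (k + 1) h = (flat k (0 + h) - flat k 0) / h"
    by (auto simp: eventually_at_filter flat_def)
  then have "((\<lambda>h. (flat k (0 + h) - flat k 0) / h) \<longlongrightarrow> 0) (at 0)"
    using flat_tendsto_0[of "k + 1"] tendsto_cong by fast
  then show ?thesis using equal by (simp add: DERIV_def flat_def)
next
  case greater
  have "((\<lambda>t. exp (- (1 / t)) / t ^ k) has_real_derivative
      (exp (- (1 / t)) * (1 / t\<^sup>2) * t ^ k - exp (- (1 / t)) * (real k * t ^ (k - 1))) / (t ^ k)\<^sup>2) (at t)"
    using greater by (auto intro!: derivative_eq_intros simp: power2_eq_square)
  then have "(flat k has_real_derivative
      (exp (- (1 / t)) * (1 / t\<^sup>2) * t ^ k - exp (- (1 / t)) * (real k * t ^ (k - 1))) / (t ^ k)\<^sup>2) (at t)"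
    by (rule has_field_derivative_transform_within_open[where S = "{0<..}"])
      (use greater in \<open>auto simp: flat_def\<close>)
  moreover have "(exp (- (1 / t)) * (1 / t\<^sup>2) * t ^ k - exp (- (1 / t)) * (real k * t ^ (k - 1))) / (t ^ k)\<^sup>2
      = flat (k + 2) t - real k * flat (k + 1) t"
    using greater by (cases k) (simp_all add: flat_def field_simps power2_eq_square)
  ultimately show ?thesis by simp
qed

lemma flat_nonneg: "0 \<le> flat k t"
  by (simp add: flat_def)

lemma flat_0_le_1: "flat 0 t \<le> 1"
  by (simp add: flat_def)

text \<open>A set of differentiable functions that is stable under \<open>partial_deriv\<close>
  consists of smooth functions, by induction on the list of directions. The generators are chosen so
  that both polynomials and bumps on boxes belong to it.\<close>

inductive_set smooth_algebra :: "(real^'n \<Rightarrow> real) set" where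
  const: "(\<lambda>_. c) \<in> smooth_algebra"
| coord: "(\<lambda>x. x $ i) \<in> smooth_algebra"
| flat: "(\<lambda>x. flat k (a * x $ i + b)) \<in> smooth_algebra"
| add: "f \<in> smooth_algebra \<Longrightarrow> g \<in> smooth_algebra \<Longrightarrow> (\<lambda>x. f x + g x) \<in> smooth_algebra"
| mult: "f \<in> smooth_algebra \<Longrightarrow> g \<in> smooth_algebra \<Longrightarrow> (\<lambda>x. f x * g x) \<in> smooth_algebra"

lemma partial_deriv_eqI:
  assumes "\<And>x. (f has_derivative D x) (at x)"
  shows "partial_deriv i f = (\<lambda>x. D x (axis i 1))"
  using frechet_derivative_at[OF assms] by (auto simp: partial_deriv_def)

lemma smooth_algebra_derivative:
  fixes f :: "real^'n \<Rightarrow> real"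
  assumes "f \<in> smooth_algebra"
  shows "(\<forall>x. f differentiable (at x)) \<and> (\<forall>j. partial_deriv j f \<in> smooth_algebra)"
  using assms
proof induction
  case (const c)
  have "partial_deriv j (\<lambda>_::real^'n. c) = (\<lambda>_. 0)" for j
    by (simp add: partial_deriv_def fun_eq_iff)
  then show ?case by (auto intro: smooth_algebra.const)
next
  case (coord i)
  have d: "((\<lambda>x::real^'n. x $ i) has_derivative (\<lambda>h. h $ i)) (at x)" for x
    by (rule bounded_linear.has_derivative[OF bounded_linear_vec_nth has_derivative_ident])
  show ?case using d unfolding partial_deriv_eqI[OF d]
    by (auto intro: smooth_algebra.const differentiableI)
next
  case (flat k a i b)
  let ?D = "\<lambda>x::real^'n. (flat (k + 2) (a * x $ i + b) - real k * flat (k + 1) (a * x $ i + b)) * a"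
  have d: "((\<lambda>x::real^'n. flat k (a * x $ i + b)) has_derivative (\<lambda>h. ?D x * h $ i)) (at x)" for x
  proof -
    have "((\<lambda>x::real^'n. a * x $ i + b) has_derivative (\<lambda>h. a * h $ i)) (at x)"
      by (auto intro!: derivative_eq_intros bounded_linear.has_derivative[OF bounded_linear_vec_nth])
    from has_derivative_compose[OF this has_real_derivative_flat[unfolded has_field_derivative_def]]
    show ?thesis by (simp add: mult.assoc)
  qed
  \<comment> \<open>The difference is written as a sum with the factor \<open>- real k\<close> so
    that the closure rules apply; \<open>a * axis j 1 $ i\<close> is a constant.\<close>
  have "(\<lambda>x::real^'n. (flat (k + 2) (a * x $ i + b) + (- real k) * flat (k + 1) (a * x $ i + b)) * (a * axis j 1 $ i))
     \<in> smooth_algebra" for j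
    by (intro smooth_algebra.intros)
  then show ?case using d unfolding partial_deriv_eqI[OF d]
    by (auto intro: differentiableI simp: mult.assoc)
next
  case (add f g)
  have d: "((\<lambda>x. f x + g x) has_derivative
      (\<lambda>h. frechet_derivative f (at x) h + frechet_derivative g (at x) h)) (at x)" for x
    using add.IH by (auto intro!: has_derivative_add simp: frechet_derivative_works)
  show ?case using d add.IH unfolding partial_deriv_eqI[OF d]
    by (auto intro: differentiableI smooth_algebra.add simp: partial_deriv_def[abs_def])
next
  case (mult f g)
  have d: "((\<lambda>x. f x * g x) has_derivative
      (\<lambda>h. f x * frechet_derivative g (at x) h + frechet_derivative f (at x) h * g x)) (at x)" for x
    using mult.IH by (auto intro!: has_derivative_mult simp: frechet_derivative_works)
  have "(\<lambda>x. f x * partial_deriv j g x + partial_deriv j f x * g x) \<in> smooth_algebra" for j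
    using mult by (intro smooth_algebra.add smooth_algebra.mult) auto
  then show ?case using d unfolding partial_deriv_eqI[OF d]
    by (auto intro: differentiableI simp: partial_deriv_def)
qed

lemma smooth_algebra_smooth:
  assumes "f \<in> smooth_algebra"
  shows "smooth f"
proof -
  have "fold partial_deriv is f \<in> smooth_algebra" for "is"
    using assms by (induction "is" arbitrary: f) (auto simp: smooth_algebra_derivative)
  then show ?thesis
    by (simp add: smooth_def smooth_algebra_derivative)
qed

lemma smooth_algebra_prod:
  "(\<And>i. i \<in> I \<Longrightarrow> f i \<in> smooth_algebra) \<Longrightarrow> (\<lambda>x. \<Prod>i\<in>I. f i x) \<in> smooth_algebra"
  by (induction I rule: infinite_finite_induct) (auto intro: smooth_algebra.intros)

lemma smooth_algebra_sum:
  "(\<And>i. i \<in> I \<Longrightarrow> f i \<in> smooth_algebra) \<Longrightarrow> (\<lambda>x. \<Sum>i\<in>I. f i x) \<in> smooth_algebra"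
  by (induction I rule: infinite_finite_induct) (auto intro: smooth_algebra.intros)

lemma polynomials_upto_smooth_algebra:
  assumes "p \<in> polynomials_upto j"
  shows "p \<in> smooth_algebra"
proof -
  obtain c where p: "p = (\<lambda>x. \<Sum>\<alpha> | (\<Sum>i\<in>UNIV. \<alpha> i) \<le> j. c \<alpha> * (\<Prod>i\<in>UNIV. x $ i ^ \<alpha> i))"
    using assms by (auto simp: polynomials_upto_def)
  have "(\<lambda>x. x $ i ^ n) \<in> smooth_algebra" for i n
    by (induction n) (auto intro: smooth_algebra.intros)
  then show ?thesis unfolding p
    by (intro smooth_algebra_sum smooth_algebra.mult smooth_algebra.const smooth_algebra_prod) auto
qed

lemma smooth_imp_differentiable: "smooth f \<Longrightarrow> f differentiable (at x)"
  unfolding smooth_def by (metis fold_Nil id_apply)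

lemma smooth_partial_deriv: "smooth f \<Longrightarrow> smooth (partial_deriv i f)"
  unfolding smooth_def by (metis fold_Cons comp_apply)

lemma smooth_continuous_on: "smooth f \<Longrightarrow> continuous_on S f"
  by (meson smooth_imp_differentiable continuous_at_imp_continuous_on differentiable_imp_continuous_within)

lemma frechet_derivative_partial:
  assumes "f differentiable (at x)"
  shows "frechet_derivative f (at x) h = (\<Sum>i\<in>UNIV. h $ i * partial_deriv i f x)"
proof -
  interpret linear "frechet_derivative f (at x)"
    using assms by (rule linear_frechet_derivative)
  have "frechet_derivative f (at x) h = frechet_derivative f (at x) (\<Sum>i\<in>UNIV. h $ i *\<^sub>R axis i 1)"
    by (metis basis_expansion scalar_mult_eq_scaleR)
  then show ?thesis by (simp add: sum scale partial_deriv_def)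
qed

section \<open>Weak gradients of piecewise smooth functions\<close>

lemma integral_lborel_translation:
  fixes f :: "'a::euclidean_space \<Rightarrow> real"
  assumes "integrable lborel f"
  shows "integrable lborel (\<lambda>x. f (x + c))" "(\<integral>x. f (x + c) \<partial>lborel) = (\<integral>x. f x \<partial>lborel)"
proof -
  have "f \<in> borel_measurable lborel" using assms by auto
  moreover have "integrable (distr lborel borel ((+) c)) f"
    using assms by (simp add: lborel_distr_plus)
  ultimately have "integrable lborel (\<lambda>x. f (c + x))"
    by (subst (asm) integrable_distr_eq) auto
  then show "integrable lborel (\<lambda>x. f (x + c))" by (simp add: add.commute)
  have "(\<integral>x. f x \<partial>distr lborel borel ((+) c)) = (\<integral>x. f (c + x) \<partial>lborel)"
    using \<open>f \<in> _\<close> by (subst integral_distr) auto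
  then show "(\<integral>x. f (x + c) \<partial>lborel) = (\<integral>x. f x \<partial>lborel)"
    by (simp add: lborel_distr_plus add.commute)
qed

text \<open>Lipschitz continuity is asked for only in the direction \<open>e\<close>, and
  \<open>D\<close> is only an almost everywhere limit. That is exactly what a continuous, piecewise
  smooth function times a test function provides.\<close>

lemma integral_directional_derivative_eq_0:
  fixes w :: "'a::euclidean_space \<Rightarrow> real"
  assumes w: "w \<in> borel_measurable borel"
    and bound: "\<And>x. \<bar>w x\<bar> \<le> B"
    and supp: "\<And>x. R < norm x \<Longrightarrow> w x = 0"
    and lip: "\<And>x h. \<bar>w (x + h *\<^sub>R e) - w x\<bar> \<le> L * \<bar>h\<bar>"
    and D: "D \<in> borel_measurable lebesgue"
    and lim: "AE x in lebesgue. ((\<lambda>h. (w (x + h *\<^sub>R e) - w x) / h) \<longlongrightarrow> D x) (at 0)"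
  shows "(\<integral>x. D x \<partial>lebesgue) = 0"
proof -
  have int_cball: "integrable lborel (\<lambda>x::'a. b * indicator (cball 0 r) x)" for b r :: real
    using emeasure_lborel_cball_finite[of "0::'a" r] by (intro integrable_mult_right) (simp add: integrable_indicator_iff)
  have w_int: "integrable lborel w"
  proof (rule Bochner_Integration.integrable_bound[OF int_cball[of B R]])
    show "AE x in lborel. norm (w x) \<le> norm (B * indicator (cball 0 R) x)"
      using bound supp by (auto simp: indicator_def not_le intro!: always_eventually order_trans[OF _ abs_ge_self])
  qed (use w in simp)
  \<comment> \<open>Step sizes in (0, 1] move the support by at most \<open>norm e\<close>, so the
    ball of radius \<open>R + norm e\<close> carries every quotient and \<open>L\<close> times its
    indicator dominates them all.\<close>
  define h where "h n = inverse (real (Suc n))" for n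
  define Q where "Q n x = (w (x + h n *\<^sub>R e) - w x) / h n" for n x
  have h: "0 < h n" "h n \<le> 1" for n by (auto simp: h_def field_simps)
  have Q_int: "integrable lborel (Q n)" "(\<integral>x. Q n x \<partial>lborel) = 0" for n
    using integral_lborel_translation[OF w_int, of "h n *\<^sub>R e"] w_int by (simp_all add: Q_def[abs_def])
  have Q0: "(\<integral>x. Q n x \<partial>lebesgue) = 0" for n
    using Q_int[of n] integral_completion[of "Q n" lborel] by (simp add: borel_measurable_integrable)
  have "(\<lambda>n. \<integral>x. Q n x \<partial>lebesgue) \<longlonglongrightarrow> (\<integral>x. D x \<partial>lebesgue)"
  proof (rule integral_dominated_convergence)
    show "D \<in> borel_measurable lebesgue" by fact
    show "Q n \<in> borel_measurable lebesgue" for n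
      using Q_int by (intro measurable_completion) auto
    show "integrable lebesgue (\<lambda>x::'a. L * indicator (cball 0 (R + norm e)) x)"
      by (subst integrable_completion) (intro borel_measurable_integrable int_cball)+
    have "h \<longlonglongrightarrow> 0" unfolding h_def by (rule LIMSEQ_inverse_real_of_nat)
    moreover have "h n \<noteq> 0" for n using h(1)[of n] by simp
    ultimately have h_at: "filterlim h (at 0) sequentially"
      by (simp add: filterlim_at)
    show "AE x in lebesgue. (\<lambda>n. Q n x) \<longlonglongrightarrow> D x"
      using lim
    proof eventually_elim
      case (elim x)
      then show ?case unfolding Q_def by (rule filterlim_compose[OF _ h_at])
    qed
    have "norm (Q n x) \<le> L * indicator (cball 0 (R + norm e)) x" for n x
    proof (cases "norm x \<le> R + norm e")
      case True
      with lip[of x "h n"] h[of n] show ?thesis by (simp add: Q_def field_simps)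
    next
      case False
      have "norm x - norm (h n *\<^sub>R e) \<le> norm (x + h n *\<^sub>R e)"
        using norm_triangle_ineq4[of "x + h n *\<^sub>R e" "h n *\<^sub>R e"] by simp
      moreover have "norm (h n *\<^sub>R e) \<le> norm e"
        using h[of n] by (simp add: mult_left_le_one_le)
      ultimately have "R < norm x" "R < norm (x + h n *\<^sub>R e)"
        using False norm_ge_zero[of e] by linarith+
      then show ?thesis using False by (simp add: Q_def supp)
    qed
    then show "AE x in lebesgue. norm (Q n x) \<le> L * indicator (cball 0 (R + norm e)) x" for n
      by simp
  qed
  then show ?thesis using Q0 by (simp add: LIMSEQ_const_iff)
qed

lemma partial_deriv_difference_quotient:
  assumes "f differentiable (at x)"
  shows "((\<lambda>h. (f (x + h *\<^sub>R axis i 1) - f x) / h) \<longlongrightarrow> partial_deriv i f x) (at 0)"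
proof -
  let ?e = "axis i 1" and ?F = "frechet_derivative f (at x)"
  have "(f has_derivative ?F) (at (x + 0 *\<^sub>R ?e))"
    using assms by (simp add: frechet_derivative_works[symmetric])
  moreover have "((\<lambda>h. x + h *\<^sub>R ?e) has_derivative (\<lambda>h. h *\<^sub>R ?e)) (at 0)"
    by (auto intro!: derivative_eq_intros)
  ultimately have "((\<lambda>h. f (x + h *\<^sub>R ?e)) has_derivative (\<lambda>h. ?F (h *\<^sub>R ?e))) (at 0)"
    by (rule has_derivative_compose[rotated])
  moreover have "(\<lambda>h. ?F (h *\<^sub>R ?e)) = (\<lambda>h. partial_deriv i f x * h)"
    using linear_scale[OF linear_frechet_derivative[OF assms]] by (simp add: partial_deriv_def mult.commute)
  ultimately have "((\<lambda>h. f (x + h *\<^sub>R ?e)) has_real_derivative partial_deriv i f x) (at 0)"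
    by (simp add: has_field_derivative_def)
  then show ?thesis by (simp add: DERIV_def)
qed

section \<open>Test functions, locality of derivatives and Lipschitz bounds\<close>

lemma test_functionsD:
  assumes "\<psi> \<in> test_functions \<Omega>"
  shows "smooth \<psi>" "compact (closure {x. \<psi> x \<noteq> 0})" "closure {x. \<psi> x \<noteq> 0} \<subseteq> \<Omega>"
  using assms by (auto simp: test_functions_def)

lemma partial_deriv_transform_open:
  assumes "open U" "x \<in> U" "\<And>y. y \<in> U \<Longrightarrow> f y = g y" "g differentiable (at x)"
  shows "f differentiable (at x)" "partial_deriv i f x = partial_deriv i g x"
proof -
  have "(f has_derivative frechet_derivative g (at x)) (at x)"
    by (rule has_derivative_transform_within_open[OF _ assms(1,2)])
      (use assms in \<open>auto simp: frechet_derivative_works[symmetric]\<close>)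
  then show "f differentiable (at x)" "partial_deriv i f x = partial_deriv i g x"
    using frechet_derivative_at[of f "frechet_derivative g (at x)" x]
    by (simp_all add: differentiableI partial_deriv_def)
qed

lemma support_complement_eq_0: "x \<notin> closure {x. f x \<noteq> 0} \<Longrightarrow> f x = 0"
  using closure_subset[of "{x. f x \<noteq> 0}"] by auto

lemma partial_deriv_support_complement:
  assumes "x \<notin> closure {x. f x \<noteq> 0}"
  shows "partial_deriv i f x = 0"
proof -
  have "partial_deriv i f x = partial_deriv i (\<lambda>_. 0) x"
    by (rule partial_deriv_transform_open(2)[of "- closure {x. f x \<noteq> 0}"])
      (use assms in \<open>auto intro: support_complement_eq_0\<close>)
  then show ?thesis by (simp add: partial_deriv_def)
qed

lemma test_function_partial_deriv:
  assumes "\<psi> \<in> test_functions \<Omega>"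
  shows "partial_deriv i \<psi> \<in> test_functions \<Omega>"
proof -
  note \<psi> = test_functionsD[OF assms]
  let ?K = "closure {x. \<psi> x \<noteq> 0}"
  have "partial_deriv i \<psi> x = 0" if "x \<notin> ?K" for x
    using that by (rule partial_deriv_support_complement)
  then have "closure {x. partial_deriv i \<psi> x \<noteq> 0} \<subseteq> ?K"
    by (intro closure_minimal) auto
  then show ?thesis
    using \<psi> compact_Int_closed[OF \<psi>(2) closed_closure[of "{x. partial_deriv i \<psi> x \<noteq> 0}"]]
    by (auto simp: test_functions_def smooth_partial_deriv inf.absorb2)
qed

lemma test_function_bounded:
  assumes "\<psi> \<in> test_functions \<Omega>"
  obtains B where "\<And>x. \<bar>\<psi> x\<bar> \<le> B"
proof -
  note \<psi> = test_functionsD[OF assms]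
  have "bounded (\<psi> ` closure {x. \<psi> x \<noteq> 0})"
    using \<psi> by (intro compact_imp_bounded compact_continuous_image smooth_continuous_on)
  then obtain B where B: "\<And>x. x \<in> closure {x. \<psi> x \<noteq> 0} \<Longrightarrow> \<bar>\<psi> x\<bar> \<le> B" "0 < B"
    by (auto simp: bounded_pos)
  have "\<bar>\<psi> x\<bar> \<le> B" for x
    using B closure_subset[of "{x. \<psi> x \<noteq> 0}"] by (cases "\<psi> x = 0") auto
  then show ?thesis using that by blast
qed

lemma test_function_measurable:
  assumes "\<psi> \<in> test_functions \<Omega>"
  shows "\<psi> \<in> borel_measurable (lebesgue_on S)"
proof -
  have "\<psi> \<in> borel_measurable borel"
    using smooth_continuous_on[OF test_functionsD(1)[OF assms]] by (rule borel_measurable_continuous_onI)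
  then show ?thesis
    by (intro measurable_restrict_space1 measurable_completion) simp
qed

text \<open>Compactness bounds each partial derivative on \<open>K\<close>, and convexity lets the
  mean value inequality run inside \<open>K\<close>. The constant is the sum of the coordinate
  bounds, because every coordinate of a direction is at most its norm.\<close>

lemma lipschitz_on_compact_convex:
  fixes f :: "real^'n \<Rightarrow> real"
  assumes K: "compact K" "convex K" and f: "\<And>x. f differentiable (at x)"
    and cont: "\<And>i. continuous_on K (partial_deriv i f)"
  obtains L where "L-lipschitz_on K f"
proof -
  have "\<exists>B. \<forall>x\<in>K. \<bar>partial_deriv i f x\<bar> \<le> B" for i
    using compact_imp_bounded[OF compact_continuous_image[OF cont K(1)]] by (auto simp: bounded_iff)
  then obtain B where B: "\<And>i x. x \<in> K \<Longrightarrow> \<bar>partial_deriv i f x\<bar> \<le> B i" by metis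
  let ?L = "\<Sum>i\<in>UNIV. \<bar>B i\<bar>"
  have "?L-lipschitz_on K f"
  proof (rule bounded_derivative_imp_lipschitz[OF _ K(2)])
    show "(f has_derivative frechet_derivative f (at x)) (at x within K)" for x
      using f by (simp add: frechet_derivative_works has_derivative_at_withinI)
    show "onorm (frechet_derivative f (at x)) \<le> ?L" if "x \<in> K" for x
    proof (rule onorm_le)
      fix h
      have "norm (frechet_derivative f (at x) h) \<le> (\<Sum>i\<in>UNIV. \<bar>h $ i\<bar> * \<bar>partial_deriv i f x\<bar>)"
        unfolding frechet_derivative_partial[OF f] real_norm_def
        by (rule order_trans[OF sum_abs]) (simp add: abs_mult)
      also have "\<dots> \<le> (\<Sum>i\<in>UNIV. norm h * \<bar>B i\<bar>)"
        using B[OF that] by (intro sum_mono mult_mono component_le_norm_cart)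
          (auto intro: order_trans[OF _ abs_ge_self])
      finally show "norm (frechet_derivative f (at x) h) \<le> ?L * norm h"
        by (simp add: sum_distrib_left mult.commute)
    qed
    show "0 \<le> ?L" by (simp add: sum_nonneg)
  qed
  then show ?thesis by (rule that)
qed

lemma partial_deriv_mult:
  assumes "f differentiable (at x)" "g differentiable (at x)"
  shows "((\<lambda>x. f x * g x) has_derivative (\<lambda>h. f x * frechet_derivative g (at x) h + frechet_derivative f (at x) h * g x)) (at x)"
   "partial_deriv i (\<lambda>x. f x * g x) x = f x * partial_deriv i g x + partial_deriv i f x * g x"
proof -
  show d: "((\<lambda>x. f x * g x) has_derivative (\<lambda>h. f x * frechet_derivative g (at x) h + frechet_derivative f (at x) h * g x)) (at x)"
    using assms by (auto intro!: has_derivative_mult simp: frechet_derivative_works)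
  show "partial_deriv i (\<lambda>x. f x * g x) x = f x * partial_deriv i g x + partial_deriv i f x * g x"
    by (simp add: partial_deriv_def frechet_derivative_at[OF d, symmetric])
qed

lemma integrable_bounded_lebesgue_on:
  fixes f :: "'a::euclidean_space \<Rightarrow> 'b::euclidean_space"
  assumes "S \<in> lmeasurable" "f \<in> borel_measurable (lebesgue_on S)" "\<And>x. x \<in> S \<Longrightarrow> norm (f x) \<le> B"
  shows "integrable (lebesgue_on S) f"
proof -
  interpret finite_measure "lebesgue_on S" using assms(1) by (rule finite_measure_lebesgue_on)
  show ?thesis using assms by (intro integrable_const_bound[where B = B]) (auto intro: AE_I2)
qed

lemma L2_bounded:
  assumes "S \<in> lmeasurable" "f \<in> borel_measurable (lebesgue_on S)" "\<And>x. x \<in> S \<Longrightarrow> norm (f x) \<le> B"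
  shows "f \<in> L2 S"
proof -
  have "norm ((norm (f x))\<^sup>2) \<le> B\<^sup>2" if "x \<in> S" for x
    using assms(3)[OF that] by (simp add: power_mono)
  then have "integrable (lebesgue_on S) (\<lambda>x. (norm (f x))\<^sup>2)"
    using assms by (intro integrable_bounded_lebesgue_on) auto
  then show ?thesis using assms by (simp add: L2_def)
qed

lemma measurable_lebesgue_on_borel:
  "f \<in> borel_measurable borel \<Longrightarrow> f \<in> borel_measurable (lebesgue_on S)"
  by (intro measurable_restrict_space1 measurable_completion) simp

text \<open>
  The difference quotients of \<open>u * \<psi>\<close> are bounded and have integral zero by translation invariance;
  dominated convergence gives the integration by parts without any boundary terms on the pieces.
\<close>

lemma has_weak_grad_piecewise_smooth:
  fixes \<Omega> :: "(real^'n) set"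
  assumes \<Omega>: "open \<Omega>" "bounded \<Omega>"
    and \<T>: "finite \<T>" "\<And>T. T \<in> \<T> \<Longrightarrow> compact T" "\<And>T. T \<in> \<T> \<Longrightarrow> convex T" "\<Omega> \<subseteq> \<Union>\<T>"
    and cont: "continuous_on (closure \<Omega>) u"
    and p: "\<And>T. T \<in> \<T> \<Longrightarrow> smooth (p T)" "\<And>T x. T \<in> \<T> \<Longrightarrow> x \<in> T \<Longrightarrow> u x = p T x"
  shows "has_weak_grad \<Omega> u
    (\<lambda>x. if x \<in> (\<Union>T\<in>\<T>. interior T) then \<chi> i. partial_deriv i u x else 0)"
    (is "has_weak_grad _ _ ?G")
proof -
  have \<Omega>_lm: "\<Omega> \<in> lmeasurable"
    using \<Omega> by (simp add: lmeasurable_open)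
  have u_int: "u differentiable (at x)" "partial_deriv i u x = partial_deriv i (p T) x"
    if T: "T \<in> \<T>" "x \<in> interior T" for T x i
  proof -
    have "u y = p T y" if "y \<in> interior T" for y
      using that T(1) p(2) interior_subset by blast
    from partial_deriv_transform_open[OF open_interior T(2) this smooth_imp_differentiable[OF p(1)[OF T(1)]]]
    show "u differentiable (at x)" "partial_deriv i u x = partial_deriv i (p T) x" by auto
  qed
  have "bounded (\<Union>T\<in>\<T>. partial_deriv i (p T) ` T)" for i
    using \<T> p by (intro bounded_UN compact_imp_bounded compact_continuous_image ballI
      smooth_continuous_on smooth_partial_deriv) auto
  then have "\<exists>B>0. \<forall>T\<in>\<T>. \<forall>x\<in>T. \<bar>partial_deriv i (p T) x\<bar> \<le> B" for i
    by (force simp: bounded_pos)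
  then obtain B where B: "\<And>i. B i > 0" "\<And>i T x. T \<in> \<T> \<Longrightarrow> x \<in> T \<Longrightarrow> \<bar>partial_deriv i (p T) x\<bar> \<le> B i"
    by metis
  have G_bound: "\<bar>?G x $ i\<bar> \<le> B i" for x i
    using B(1)[of i] B(2) u_int(2) interior_subset by (auto simp: less_imp_le) blast
  \<comment> \<open>The space is cut into finitely many Borel pieces: the interiors of the elements,
    where \<open>?G\<close> is the continuous gradient of \<open>p T\<close>, and the closed
    complement of their union, where it is 0.\<close>
  have G_meas: "?G \<in> borel_measurable borel"
  proof (rule measurable_piecewise_restrict[of "insert (- (\<Union>T\<in>\<T>. interior T)) (interior ` \<T>)"])
    fix X assume "X \<in> insert (- (\<Union>T\<in>\<T>. interior T)) (interior ` \<T>)"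
    then consider "X = - (\<Union>T\<in>\<T>. interior T)" | T where "T \<in> \<T>" "X = interior T" by auto
    then show "?G \<in> borel_measurable (restrict_space borel X)"
    proof cases
      case 1
      have "(\<lambda>_. 0) \<in> borel_measurable (restrict_space borel X)" by simp
      then show ?thesis
        by (rule measurable_cong[THEN iffD1, rotated]) (auto simp: 1 space_restrict_space)
    next
      case 2
      have "(\<lambda>x. \<chi> i. partial_deriv i (p T) x) \<in> borel_measurable (restrict_space borel X)"
        using p 2 by (intro borel_measurable_continuous_on_restrict continuous_on_vec_lambda
            smooth_continuous_on smooth_partial_deriv) auto
      then show ?thesis
        by (rule measurable_cong[THEN iffD1, rotated])
          (use 2 u_int(2) in \<open>auto simp: space_restrict_space vec_eq_iff\<close>)
    qed
    have "open (\<Union>T\<in>\<T>. interior T)" by auto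
    then have "X \<in> sets borel"
      using \<open>X \<in> insert _ _\<close> by (auto intro: borel_comp simp del: Compl_UN)
    then show "X \<inter> space borel \<in> sets borel" by simp
  qed (use \<T>(1) in \<open>auto intro: countable_finite\<close>)
  have Gi_meas: "(\<lambda>x. ?G x $ i) \<in> borel_measurable borel" for i
    by (rule measurable_compose[OF G_meas]) simp
  have "compact (closure \<Omega>)" using \<Omega> by simp
  then have "bounded (u ` closure \<Omega>)"
    by (intro compact_imp_bounded compact_continuous_image cont)
  then obtain Bu where Bu: "\<And>x. x \<in> closure \<Omega> \<Longrightarrow> \<bar>u x\<bar> \<le> Bu" "Bu > 0"
    by (auto simp: bounded_pos)
  have Bu': "\<bar>u x\<bar> \<le> Bu" if "x \<in> \<Omega>" for x
    using Bu that closure_subset by blast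
  have u_meas: "u \<in> borel_measurable (lebesgue_on \<Omega>)"
    using continuous_on_subset[OF cont closure_subset] \<Omega>(1)
    by (intro continuous_imp_measurable_on_sets_lebesgue) auto
  have "u \<in> L2 \<Omega>"
    using \<Omega>_lm u_meas Bu' by (intro L2_bounded[where B = Bu]) auto
  moreover have "?G \<in> L2 \<Omega>"
  proof (rule L2_bounded[OF \<Omega>_lm measurable_lebesgue_on_borel[OF G_meas]])
    show "norm (?G x) \<le> (\<Sum>i\<in>UNIV. B i)" for x
      by (rule order_trans[OF norm_le_l1_cart]) (rule sum_mono, rule G_bound)
  qed
  moreover have "(\<integral>x. u x * partial_deriv i \<psi> x \<partial>lebesgue_on \<Omega>) = - (\<integral>x. ?G x $ i * \<psi> x \<partial>lebesgue_on \<Omega>)"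
    if \<psi>: "\<psi> \<in> test_functions \<Omega>" for \<psi> i
  proof -
    let ?K = "closure {x. \<psi> x \<noteq> 0}"
    let ?e = "axis i 1 :: real^'n"
    let ?w = "\<lambda>x. u x * \<psi> x"
    note \<psi>_smooth = test_functionsD[OF \<psi>]
    have \<psi>_diff: "\<psi> differentiable (at x)" for x
      using \<psi>_smooth(1) by (rule smooth_imp_differentiable)
    have \<psi>0: "\<psi> x = 0" if "x \<notin> ?K" for x
      using that by (rule support_complement_eq_0)
    have \<psi>_out: "\<psi> x = 0" if "x \<notin> \<Omega>" for x
      using that \<psi>_smooth(3) by (intro \<psi>0) auto
    have \<psi>0': "partial_deriv i \<psi> x = 0" if "x \<notin> ?K" for x
      using that by (rule partial_deriv_support_complement)
    obtain B0 where B0: "\<And>x. \<bar>\<psi> x\<bar> \<le> B0" by (rule test_function_bounded[OF \<psi>]) blast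
    obtain B1 where B1: "\<And>x. \<bar>partial_deriv i \<psi> x\<bar> \<le> B1"
      by (rule test_function_bounded[OF test_function_partial_deriv[OF \<psi>, of i]]) blast
    have int1: "integrable (lebesgue_on \<Omega>) (\<lambda>x. u x * partial_deriv i \<psi> x)"
    proof (rule integrable_bounded_lebesgue_on[OF \<Omega>_lm])
      show "(\<lambda>x. u x * partial_deriv i \<psi> x) \<in> borel_measurable (lebesgue_on \<Omega>)"
        using u_meas test_function_measurable[OF test_function_partial_deriv[OF \<psi>]]
        by (rule borel_measurable_times)
      show "norm (u x * partial_deriv i \<psi> x) \<le> Bu * B1" if "x \<in> \<Omega>" for x
        unfolding real_norm_def abs_mult using Bu'[OF that] B1 Bu(2) by (intro mult_mono) auto
    qed
    have int2: "integrable (lebesgue_on \<Omega>) (\<lambda>x. ?G x $ i * \<psi> x)"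
    proof (rule integrable_bounded_lebesgue_on[OF \<Omega>_lm])
      show "(\<lambda>x. ?G x $ i * \<psi> x) \<in> borel_measurable (lebesgue_on \<Omega>)"
        using measurable_lebesgue_on_borel[OF Gi_meas] test_function_measurable[OF \<psi>]
        by (rule borel_measurable_times)
      show "norm (?G x $ i * \<psi> x) \<le> B i * B0" if "x \<in> \<Omega>" for x
        unfolding real_norm_def abs_mult using G_bound B0 B(1)[of i] by (intro mult_mono) auto
    qed
    obtain R where R: "\<And>x. x \<in> ?K \<Longrightarrow> norm x \<le> R"
      using compact_imp_bounded[OF \<psi>_smooth(2)] by (auto simp: bounded_iff)
    \<comment> \<open>On a single element the product coincides with \<open>p T\<close> times the
      test function, which is smooth on the whole space.\<close>
    have "\<exists>L. L-lipschitz_on T ?w" if T: "T \<in> \<T>" for T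
    proof -
      have d: "p T differentiable (at x)" for x
        using p(1)[OF T] by (rule smooth_imp_differentiable)
      have "partial_deriv j (\<lambda>x. p T x * \<psi> x)
          = (\<lambda>x. p T x * partial_deriv j \<psi> x + partial_deriv j (p T) x * \<psi> x)" for j
        using partial_deriv_mult(2)[OF d \<psi>_diff] by auto
      then have c: "continuous_on T (partial_deriv j (\<lambda>x. p T x * \<psi> x))" for j
        by (simp only:) (intro continuous_on_add continuous_on_mult smooth_continuous_on
          smooth_partial_deriv p(1)[OF T] \<psi>_smooth(1))
      have "(\<lambda>x. p T x * \<psi> x) differentiable (at x)" for x
        using d \<psi>_diff by simp
      then obtain L where "L-lipschitz_on T (\<lambda>x. p T x * \<psi> x)"
        using lipschitz_on_compact_convex[OF \<T>(2)[OF T] \<T>(3)[OF T] _ c] by blast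
      then have "L-lipschitz_on T ?w"
        by (rule lipschitz_on_transform) (use p(2)[OF T] in auto)
      then show ?thesis ..
    qed
    then obtain L where L: "\<And>T. T \<in> \<T> \<Longrightarrow> (L T)-lipschitz_on T ?w" by metis
    have L_nonneg: "0 \<le> L T" if "T \<in> \<T>" for T using L[OF that] by (rule lipschitz_on_nonneg)
    \<comment> \<open>The constants are nonnegative, so their sum over the finite mesh dominates
      each of them and serves all elements at once.\<close>
    define M where "M = (\<Sum>T\<in>\<T>. L T)"
    have M: "M-lipschitz_on T ?w" "0 \<le> M" if "T \<in> \<T>" for T
      using that L L_nonneg \<T>(1) unfolding M_def
      by (auto intro: lipschitz_on_le member_le_sum sum_nonneg)
    have M0: "0 \<le> M" unfolding M_def using L_nonneg by (rule sum_nonneg)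
    let ?D = "\<lambda>x. indicator \<Omega> x *\<^sub>R (u x * partial_deriv i \<psi> x + ?G x $ i * \<psi> x)"
    have "(\<integral>x. ?D x \<partial>lebesgue) = 0"
    proof (rule integral_directional_derivative_eq_0[where w = ?w and e = ?e])
      \<comment> \<open>Off the closure of \<Omega> the values of \<open>u\<close> are arbitrary,
        but the test function vanishes there. So the product equals its cut-off to the closed set on
        which \<open>u\<close> is continuous.\<close>
      have "(\<lambda>x. indicator (closure \<Omega>) x *\<^sub>R ?w x) \<in> borel_measurable borel"
        using cont smooth_continuous_on[OF \<psi>_smooth(1)]
        by (intro borel_measurable_continuous_on_indicator continuous_on_mult) auto
      moreover have "(\<lambda>x. indicator (closure \<Omega>) x *\<^sub>R ?w x) = ?w"
      proof
        show "indicator (closure \<Omega>) x *\<^sub>R ?w x = ?w x" for x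
          using \<psi>_out[of x] closure_subset[of \<Omega>] by (cases "x \<in> closure \<Omega>") auto
      qed
      ultimately show "?w \<in> borel_measurable borel" by simp
      show "\<bar>?w x\<bar> \<le> Bu * B0" for x
      proof (cases "x \<in> \<Omega>")
        case True
        then show ?thesis unfolding abs_mult using Bu' B0 Bu(2) by (intro mult_mono) auto
      next
        case False
        then have "\<psi> x = 0" by (rule \<psi>_out)
        then show ?thesis using Bu(2) order_trans[OF abs_ge_zero B0[of x]] by simp
      qed
      show "?w x = 0" if "R < norm x" for x
        using R[of x] that \<psi>0[of x] by auto
      show "\<bar>?w (x + h *\<^sub>R ?e) - ?w x\<bar> \<le> M * \<bar>h\<bar>" for x h
      proof -
        let ?l = "\<lambda>t. x + t *\<^sub>R ?e"
        have cl: "continuous_on UNIV ?l" by (intro continuous_intros)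
        \<comment> \<open>The line through \<open>x\<close> may leave \<Omega> and the mesh. Its
          parameters are covered by finitely many closed sets: the preimages of the elements, and
          the zero set of the test function, on which the product is 0. A Lipschitz bound on each
          closed piece passes to the interval, whose end points are ordered by min and max to allow
          for negative \<open>h\<close>.\<close>
        have "M-lipschitz_on {min 0 h..max 0 h} (?w \<circ> ?l)"
        proof (rule lipschitz_on_closed_Union[where I = "insert {t. \<psi> (?l t) = 0} ((\<lambda>T. ?l -` T) ` \<T>)" and U = id])
          fix X assume X: "X \<in> insert {t. \<psi> (?l t) = 0} ((\<lambda>T. ?l -` T) ` \<T>)"
          have lip_T: "M-lipschitz_on (?l -` T) (?w \<circ> ?l)" if "T \<in> \<T>" for T
          proof (rule lipschitz_onI[OF _ M0])
            fix s t assume "s \<in> ?l -` T" "t \<in> ?l -` T"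
            then have "dist (?w (?l s)) (?w (?l t)) \<le> M * dist (?l s) (?l t)"
              by (intro lipschitz_onD[OF M(1)[OF that]]) simp_all
            moreover have "dist (?l s) (?l t) = dist s t" by (simp add: dist_real_def)
            ultimately show "dist ((?w \<circ> ?l) s) ((?w \<circ> ?l) t) \<le> M * dist s t"
              by (simp only: o_apply)
          qed
          have lip_0: "M-lipschitz_on {t. \<psi> (?l t) = 0} (?w \<circ> ?l)"
            using M0 by (auto intro!: lipschitz_onI)
          show "M-lipschitz_on (id X) (?w \<circ> ?l)"
            using X lip_T lip_0 by (elim insertE imageE) simp_all
          have "closed {t. \<psi> (?l t) = 0}"
            using continuous_on_compose2[OF smooth_continuous_on[OF \<psi>_smooth(1), of UNIV] cl]
            by (intro closed_Collect_eq) auto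
          moreover have "closed (?l -` T)" if "T \<in> \<T>" for T
            using closed_vimage[OF compact_imp_closed[OF \<T>(2)[OF that]] cl] .
          ultimately show "closed (id X)"
            using X by (elim insertE imageE) simp_all
        next
          show "{min 0 h..max 0 h} \<subseteq> (\<Union>X\<in>insert {t. \<psi> (?l t) = 0} ((\<lambda>T. ?l -` T) ` \<T>). id X)"
          proof
            fix t
            show "t \<in> (\<Union>X\<in>insert {t. \<psi> (?l t) = 0} ((\<lambda>T. ?l -` T) ` \<T>). id X)"
              using \<psi>_out[of "?l t"] \<T>(4) by (cases "?l t \<in> \<Omega>") auto
          qed
        qed (use \<T>(1) M0 in auto)
        from lipschitz_onD[OF this, of h 0] show ?thesis by (simp add: dist_norm)
      qed
      show "?D \<in> borel_measurable lebesgue"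
        using int1 int2 \<Omega>(1) by (subst borel_measurable_restrict_space_iff[symmetric])
          (auto intro!: borel_measurable_add borel_measurable_integrable)
      \<comment> \<open>Boundaries of convex sets are null. Hence almost every point of an element
        is an interior point, where \<open>u\<close> is locally the smooth function
        \<open>p T\<close>.\<close>
      have "negligible (\<Union>T\<in>\<T>. frontier T)"
        using \<T>(1,3) by (intro negligible_Union) (auto intro: negligible_convex_frontier)
      then have "AE x in lebesgue. x \<notin> (\<Union>T\<in>\<T>. frontier T)"
        by (intro AE_not_in) (simp add: negligible_iff_null_sets)
      then show "AE x in lebesgue. ((\<lambda>h. (?w (x + h *\<^sub>R ?e) - ?w x) / h) \<longlongrightarrow> ?D x) (at 0)"
      proof eventually_elim
        case (elim x)
        \<comment> \<open>The split is by the closed support rather than by \<Omega>: on the support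
          \<open>u\<close> is controlled because it lies in \<Omega>, and off it the product is
          locally constantly 0, whatever \<open>u\<close> does.\<close>
        have "?w differentiable (at x) \<and> partial_deriv i ?w x = ?D x"
        proof (cases "x \<in> ?K")
          case True
          then have "x \<in> \<Omega>" using \<psi>_smooth by auto
          then obtain T where T: "T \<in> \<T>" "x \<in> T" using \<T>(4) by auto
          then have x: "x \<in> interior T"
            using elim \<T>(2)[OF T(1)] by (auto simp: frontier_def compact_imp_closed)
          have d: "u differentiable (at x)" by (rule u_int(1)[OF T(1) x])
          have "?G x $ i = partial_deriv i u x" using T(1) x by auto
          with \<open>x \<in> \<Omega>\<close> have "?D x = u x * partial_deriv i \<psi> x + partial_deriv i u x * \<psi> x"
            by (simp only: indicator_simps scaleR_one)
          then show ?thesis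
            using differentiable_mult[OF d \<psi>_diff] partial_deriv_mult(2)[OF d \<psi>_diff, of i]
            by (simp only: simp_thms)
        next
          case False
          have w0: "?w y = 0" if "y \<in> - ?K" for y using \<psi>0[of y] that by simp
          have "x \<in> - ?K" using False by simp
          note transform = partial_deriv_transform_open[OF open_Compl[OF closed_closure] this w0 differentiable_const]
          have "?w differentiable (at x)" "partial_deriv i ?w x = partial_deriv i (\<lambda>_. 0) x"
            by (rule transform; assumption)+
          then show ?thesis using \<psi>0[OF False] \<psi>0'[OF False] by (simp add: partial_deriv_def)
        qed
        then show ?case using partial_deriv_difference_quotient[of ?w x i] by simp
      qed
    qed
    then have "(\<integral>x. (u x * partial_deriv i \<psi> x + ?G x $ i * \<psi> x) \<partial>lebesgue_on \<Omega>) = 0"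
      using \<Omega>(1) by (subst integral_restrict_space) auto
    then show ?thesis
      using Bochner_Integration.integral_add[OF int1 int2] by linarith
  qed
  ultimately show ?thesis by (auto simp: has_weak_grad_def)
qed

lemma fe_space_subset_H1:
  fixes \<Omega> :: "(real^'n) set"
  assumes "open \<Omega>" "bounded \<Omega>" "conforming_mesh \<Omega> \<T>" "u \<in> fe_space \<Omega> \<T> j"
  shows "u \<in> H1 \<Omega>"
proof -
  obtain p where p: "\<And>T. T \<in> \<T> \<Longrightarrow> p T \<in> polynomials_upto j" "\<And>T x. T \<in> \<T> \<Longrightarrow> x \<in> T \<Longrightarrow> u x = p T x"
    using assms(4) unfolding fe_space_def by simp metis
  have mesh: "finite \<T>" "\<And>T. T \<in> \<T> \<Longrightarrow> int CARD('n) simplex T" "\<Union>\<T> = closure \<Omega>"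
    using assms(3) by (auto simp: conforming_mesh_def triangulation_def)
  have cover: "\<Omega> \<subseteq> \<Union>\<T>" using mesh(3) closure_subset by simp
  have "has_weak_grad \<Omega> u (\<lambda>x. if x \<in> (\<Union>T\<in>\<T>. interior T) then \<chi> i. partial_deriv i u x else 0)"
  proof (rule has_weak_grad_piecewise_smooth[OF assms(1,2) mesh(1)])
    show "compact T" "convex T" if "T \<in> \<T>" for T
      using mesh(2)[OF that] compact_simplex convex_simplex by auto
    show "smooth (p T)" if "T \<in> \<T>" for T
      using p(1)[OF that] by (intro smooth_algebra_smooth polynomials_upto_smooth_algebra)
  qed (use assms(4) p(2) cover in \<open>auto simp: fe_space_def\<close>)
  then show ?thesis by (auto simp: H1_def)
qed

section \<open>Uniqueness of weak gradients\<close>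

text \<open>Open boxes are stable under intersection and generate the Borel sets, so inside one
  fixed box the integrals over all Borel sets vanish by induction over the generated sigma-algebra.
  Uniqueness of densities then gives 0 on that box, and countably many boxes exhaust
  \<Omega>.\<close>

lemma AE_0_if_integral_boxes_0:
  fixes f :: "'a::euclidean_space \<Rightarrow> real"
  assumes "open \<Omega>" and f: "integrable lborel f"
    and boxes: "\<And>a b. cbox a b \<subseteq> \<Omega> \<Longrightarrow> (\<integral>x. indicator (box a b) x * f x \<partial>lborel) = 0"
  shows "AE x in lborel. x \<in> \<Omega> \<longrightarrow> f x = 0"
proof -
  have f_ind: "integrable lborel (\<lambda>x. indicator A x * f x)" if "A \<in> sets borel" for A
    using integrable_mult_indicator[of A lborel f] that f by simp
  have box0: "AE x in lborel. indicator (box a b) x * f x = 0" if ab: "cbox a b \<subseteq> \<Omega>" for a b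
  proof (rule density_unique_real)
    let ?h = "\<lambda>x. indicator (box a b) x * f x"
    show h: "integrable lborel ?h" by (rule f_ind) simp
    show "integrable lborel (\<lambda>_::'a. 0::real)" by simp
    fix A :: "'a set" assume "A \<in> sets lborel"
    then have A: "A \<in> sigma_sets UNIV (range (\<lambda>(a, b). box a b))"
      by (simp add: borel_eq_box)
    have h_ind: "integrable lborel (\<lambda>x. indicator A x * ?h x)" if "A \<in> sets borel" for A
      using integrable_mult_indicator[of A lborel ?h] that h by simp
    have "Int_stable (range (\<lambda>(a, b). box a b :: 'a set))"
      by (auto simp: Int_stable_def box_Int_box)
    moreover have "range (\<lambda>(a, b). box a b :: 'a set) \<subseteq> Pow UNIV" by simp
    ultimately have "(\<integral>x. indicator A x * ?h x \<partial>lborel) = 0"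
      using A
    proof (induction rule: sigma_sets_induct_disjoint)
      case (basic A)
      then obtain c d where A: "A = box c d" by auto
      have eq: "indicator A x * ?h x = indicator (A \<inter> box a b) x * f x" for x
        by (simp add: indicator_inter_arith)
      show ?case
      proof (cases "A \<inter> box a b = {}")
        case True
        then show ?thesis unfolding eq by simp
      next
        case False
        let ?c = "\<Sum>i\<in>Basis. max (c \<bullet> i) (a \<bullet> i) *\<^sub>R i"
        let ?d = "\<Sum>i\<in>Basis. min (d \<bullet> i) (b \<bullet> i) *\<^sub>R i"
        have I: "A \<inter> box a b = box ?c ?d" unfolding A by (rule box_Int_box)
        have "cbox ?c ?d \<subseteq> cbox a b"
          by (rule subset_box_imp) (auto simp: subset_box)
        with ab have "cbox ?c ?d \<subseteq> \<Omega>" by simp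
        then show ?thesis unfolding eq I by (rule boxes)
      qed
    next
      case empty
      then show ?case by simp
    next
      case (compl A)
      then have A: "A \<in> sets borel" by (simp add: borel_eq_box)
      \<comment> \<open>The integral of \<open>?h\<close> over the whole space is the integral of
        \<open>f\<close> over \<open>box a b\<close>, which is 0 by hypothesis; this is what makes
        complements work.\<close>
      have "indicator (UNIV - A) x * ?h x = ?h x - indicator A x * ?h x" for x
        by (simp add: indicator_def)
      then show ?case
        using Bochner_Integration.integral_diff[OF h h_ind[OF A]] boxes[OF ab] compl by simp
    next
      case (union F)
      then have F: "F i \<in> sets borel" for i by (auto simp: borel_eq_box)
      have "(LINT x:(\<Union>i. F i)|lborel. ?h x) = (\<Sum>i. LINT x:F i|lborel. ?h x)"
        using union(1) F h_ind[of "\<Union>i. F i"]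
        by (intro lebesgue_integral_countable_add) (auto simp: set_integrable_def disjoint_family_on_def)
      then show ?case using union by (simp add: set_lebesgue_integral_def)
    qed
    then show "(LINT x:A|lborel. ?h x) = (LINT x:A|lborel. 0)"
      by (simp add: set_lebesgue_integral_def)
  qed
  obtain \<D> where \<D>: "countable \<D>" "\<D> \<subseteq> Pow \<Omega>" "\<And>X. X \<in> \<D> \<Longrightarrow> \<exists>a b. X = cbox a b" "\<Union>\<D> = \<Omega>"
    using open_countable_Union_open_cbox[OF \<open>open \<Omega>\<close>] by metis
  have "AE x in lborel. x \<in> X \<longrightarrow> f x = 0" if X: "X \<in> \<D>" for X
  proof -
    obtain a b where ab: "X = cbox a b" using \<D>(3)[OF X] by auto
    \<comment> \<open>The cover consists of closed boxes while the vanishing was shown on open ones;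
      the faces between them are null.\<close>
    have "AE x in lborel. x \<notin> cbox a b - box a b"
      by (intro AE_not_in) (simp add: null_sets_def emeasure_Diff emeasure_lborel_box_eq emeasure_lborel_cbox_eq box_subset_cbox)
    moreover have "cbox a b \<subseteq> \<Omega>" using X \<D>(2) ab by auto
    note box0[OF this]
    ultimately show ?thesis by eventually_elim (auto simp: ab indicator_def)
  qed
  then have "AE x in lborel. \<forall>X\<in>\<D>. x \<in> X \<longrightarrow> f x = 0"
    by (intro iffD2[OF AE_ball_countable[OF \<D>(1)]] ballI)
  then show ?thesis
    by eventually_elim (use \<D>(4) in blast)
qed

section \<open>Smooth approximation of indicators of boxes\<close>

lemma compact_closure_subset: "compact K \<Longrightarrow> closure S \<subseteq> K \<Longrightarrow> compact (closure S)"
  using compact_Int_closed[OF _ closed_closure, of K S] by (simp add: inf.absorb2)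

text \<open>Each pair of factors is nonzero only for \<open>x $ i\<close> strictly between
  \<open>a $ i\<close> and \<open>b $ i\<close>, so the support stays in the closed box for every
  \<open>c\<close>. The parameter \<open>c\<close> steepens the bump and will tend to
  infinity.\<close>

lemma box_bump_test_function:
  fixes \<Omega> :: "(real^'n) set"
  assumes "cbox a b \<subseteq> \<Omega>" "c > 0"
  shows "(\<lambda>x. \<Prod>i\<in>UNIV. flat 0 (c * (x $ i - a $ i)) * flat 0 (c * (b $ i - x $ i))) \<in> test_functions \<Omega>"
    (is "?\<psi> \<in> _")
proof -
  have "?\<psi> = (\<lambda>x. \<Prod>i\<in>UNIV. flat 0 (c * x $ i + (- c * a $ i)) * flat 0 ((- c) * x $ i + c * b $ i))"
    by (simp add: algebra_simps)
  also have "\<dots> \<in> smooth_algebra"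
    by (intro smooth_algebra_prod smooth_algebra.mult smooth_algebra.flat)
  finally have smooth: "smooth ?\<psi>" by (rule smooth_algebra_smooth)
  have "x \<in> cbox a b" if "?\<psi> x \<noteq> 0" for x
  proof -
    from that have "flat 0 (c * (x $ i - a $ i)) \<noteq> 0 \<and> flat 0 (c * (b $ i - x $ i)) \<noteq> 0" for i
      by simp
    then have "c * (x $ i - a $ i) > 0 \<and> c * (b $ i - x $ i) > 0" for i
      unfolding flat_def by metis
    then show ?thesis
      using \<open>c > 0\<close> by (simp add: mem_box_cart zero_less_mult_iff less_imp_le)
  qed
  then have "closure {x. ?\<psi> x \<noteq> 0} \<subseteq> cbox a b"
    by (intro closure_minimal closed_cbox subsetI) (simp only: mem_Collect_eq)
  moreover from this have "compact (closure {x. ?\<psi> x \<noteq> 0})"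
    by (rule compact_closure_subset[OF compact_cbox])
  ultimately show ?thesis
    using assms(1) smooth unfolding test_functions_def by (simp only: mem_Collect_eq subset_trans)
qed

text \<open>For t > 0 the value is exp (-1 / ((n + 1) t)), which tends to 1. The value 0 at t = 0 is
  the reason why the bumps converge to the indicator of the open box.\<close>

lemma flat_0_scaled_tendsto:
  "(\<lambda>n. flat 0 (real (Suc n) * t)) \<longlonglongrightarrow> (if t > 0 then 1 else 0)"
proof (cases "t > 0")
  case True
  have "(\<lambda>n. exp (- (inverse (real (Suc n)) * (1 / t)))) \<longlonglongrightarrow> exp (- (0 * (1 / t)))"
    by (intro tendsto_intros LIMSEQ_inverse_real_of_nat)
  moreover have "flat 0 (real (Suc n) * t) = exp (- (inverse (real (Suc n)) * (1 / t)))" for n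
    using True by (simp add: flat_def divide_inverse)
  ultimately show ?thesis using True by simp
next
  case False
  then have "flat 0 (real (Suc n) * t) = 0" for n
    by (auto simp: flat_def zero_less_mult_iff simp del: of_nat_Suc)
  then show ?thesis using False by simp
qed

lemma box_bump_tendsto:
  fixes a b x :: "real^'n"
  shows "(\<lambda>n. \<Prod>i\<in>UNIV. flat 0 (real (Suc n) * (x $ i - a $ i)) * flat 0 (real (Suc n) * (b $ i - x $ i)))
    \<longlonglongrightarrow> indicator (box a b) x"
proof -
  have "(\<lambda>n. \<Prod>i\<in>UNIV. flat 0 (real (Suc n) * (x $ i - a $ i)) * flat 0 (real (Suc n) * (b $ i - x $ i)))
    \<longlonglongrightarrow> (\<Prod>i\<in>UNIV. (if x $ i - a $ i > 0 then 1 else 0) * (if b $ i - x $ i > 0 then 1 else 0))"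
    by (intro tendsto_prod tendsto_mult flat_0_scaled_tendsto)
  also have "(\<Prod>i\<in>UNIV. (if x $ i - a $ i > 0 then 1 else 0) * (if b $ i - x $ i > 0 then 1 else 0))
      = (indicator (box a b) x :: real)"
  proof (cases "x \<in> box a b")
    case True
    then show ?thesis by (simp add: mem_box_cart)
  next
    case False
    then obtain i where "\<not> (a $ i < x $ i \<and> x $ i < b $ i)" by (auto simp: mem_box_cart)
    then have "(if x $ i - a $ i > 0 then 1 else 0) * (if b $ i - x $ i > 0 then 1 else 0) = (0::real)"
      by auto
    then have "(\<Prod>i\<in>UNIV. (if x $ i - a $ i > 0 then 1 else 0) * (if b $ i - x $ i > 0 then 1 else 0)) = (0::real)"
      by (intro prod_zero finite bexI[of _ i] UNIV_I)
    then show ?thesis using False by simp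
  qed
  finally show ?thesis .
qed

text \<open>The bumps take values between 0 and 1 and converge pointwise to indicators of open
  boxes, so dominated convergence with majorant |f| carries the vanishing integrals from test
  functions to boxes.\<close>

lemma fundamental_lemma_calculus_of_variations:
  fixes \<Omega> :: "(real^'n) set"
  assumes "open \<Omega>" and f: "integrable (lebesgue_on \<Omega>) f"
    and test: "\<And>\<psi>. \<psi> \<in> test_functions \<Omega> \<Longrightarrow> (\<integral>x. f x * \<psi> x \<partial>lebesgue_on \<Omega>) = 0"
  shows "AE x in lebesgue_on \<Omega>. f x = 0"
proof -
  have \<Omega>: "\<Omega> \<inter> space lebesgue \<in> sets lebesgue" using \<open>open \<Omega>\<close> by simp
  have F: "integrable lebesgue (\<lambda>x. indicator \<Omega> x * f x)"
    using f by (subst (asm) integrable_restrict_space[OF \<Omega>]) simp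
  \<comment> \<open>The argument with boxes takes place over the Borel measure
    \<open>lborel\<close>, whereas \<open>f\<close> is only Lebesgue measurable on \<Omega>. It is
    extended by 0 and replaced by a Borel function equal to it almost everywhere.\<close>
  then obtain f' where f': "f' \<in> borel_measurable lborel" "AE x in lborel. indicator \<Omega> x * f x = f' x"
    using completion_ex_borel_measurable_real borel_measurable_integrable by blast
  have ae: "AE x in lebesgue. indicator \<Omega> x * f x = f' x" using f'(2) by (rule AE_completion)
  have f'_leb: "f' \<in> borel_measurable lebesgue" using f'(1) by (rule measurable_completion)
  have "integrable lebesgue f'"
    using F ae f'_leb by (subst integrable_cong_AE[symmetric]) (auto intro: borel_measurable_integrable)
  then have f'_int: "integrable lborel f'"
    using integrable_completion[of f' lborel] f'(1) by simp
  have "AE x in lborel. x \<in> \<Omega> \<longrightarrow> f' x = 0"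
  proof (rule AE_0_if_integral_boxes_0[OF \<open>open \<Omega>\<close> f'_int])
    fix a b :: "real^'n" assume ab: "cbox a b \<subseteq> \<Omega>"
    define \<psi> where "\<psi> n x = (\<Prod>i\<in>UNIV. flat 0 (real (Suc n) * (x $ i - a $ i)) * flat 0 (real (Suc n) * (b $ i - x $ i)))" for n x
    have \<psi>_test: "\<psi> n \<in> test_functions \<Omega>" for n
      using box_bump_test_function[OF ab, of "real (Suc n)"] by (simp add: \<psi>_def[abs_def] del: of_nat_Suc)
    have \<psi>_le: "\<bar>\<psi> n x\<bar> \<le> 1" for n x
      unfolding \<psi>_def abs_prod abs_mult
      by (intro prod_le_1 conjI mult_nonneg_nonneg mult_le_one) (auto simp: flat_nonneg flat_0_le_1)
    have "(\<lambda>n. \<integral>x. f x * \<psi> n x \<partial>lebesgue_on \<Omega>) \<longlonglongrightarrow> (\<integral>x. f x * indicator (box a b) x \<partial>lebesgue_on \<Omega>)"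
    proof (rule integral_dominated_convergence[where w = "\<lambda>x. \<bar>f x\<bar>"])
      show "(\<lambda>x. f x * indicator (box a b) x) \<in> borel_measurable (lebesgue_on \<Omega>)"
        by (rule borel_measurable_times[OF borel_measurable_integrable[OF f] measurable_lebesgue_on_borel]) simp
      show "(\<lambda>x. f x * \<psi> n x) \<in> borel_measurable (lebesgue_on \<Omega>)" for n
        by (rule borel_measurable_times[OF borel_measurable_integrable[OF f] test_function_measurable[OF \<psi>_test]])
      show "integrable (lebesgue_on \<Omega>) (\<lambda>x. \<bar>f x\<bar>)" using f by simp
      show "AE x in lebesgue_on \<Omega>. (\<lambda>n. f x * \<psi> n x) \<longlonglongrightarrow> f x * indicator (box a b) x"
        unfolding \<psi>_def by (intro AE_I2 tendsto_mult tendsto_const box_bump_tendsto)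
      show "AE x in lebesgue_on \<Omega>. norm (f x * \<psi> n x) \<le> \<bar>f x\<bar>" for n
        using \<psi>_le by (intro AE_I2) (simp add: abs_mult mult_left_le)
    qed
    then have "(\<integral>x. f x * indicator (box a b) x \<partial>lebesgue_on \<Omega>) = 0"
      using test[OF \<psi>_test] by (simp add: LIMSEQ_const_iff)
    then have "(\<integral>x. indicator \<Omega> x * (f x * indicator (box a b) x) \<partial>lebesgue) = 0"
      by (subst (asm) integral_restrict_space[OF \<Omega>]) simp
    also have "(\<integral>x. indicator \<Omega> x * (f x * indicator (box a b) x) \<partial>lebesgue)
        = (\<integral>x. indicator (box a b) x * f' x \<partial>lebesgue)"
    proof (rule integral_cong_AE)
      show "(\<lambda>x. indicator \<Omega> x * (f x * indicator (box a b) x)) \<in> borel_measurable lebesgue"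
        using borel_measurable_times[OF borel_measurable_integrable[OF F], of "indicator (box a b)"]
        by (simp add: mult.assoc measurable_completion)
      show "(\<lambda>x. indicator (box a b) x * f' x) \<in> borel_measurable lebesgue"
        using f'(1) by (intro measurable_completion) simp
      show "AE x in lebesgue. indicator \<Omega> x * (f x * indicator (box a b) x) = indicator (box a b) x * f' x"
        using ae by eventually_elim (simp add: mult_ac)
    qed
    also have "\<dots> = (\<integral>x. indicator (box a b) x * f' x \<partial>lborel)"
      using f'(1) by (intro integral_completion) simp
    finally show "(\<integral>x. indicator (box a b) x * f' x \<partial>lborel) = 0" by simp
  qed
  then have "AE x in lebesgue. x \<in> \<Omega> \<longrightarrow> f' x = 0" by (rule AE_completion)
  with ae have "AE x in lebesgue. x \<in> \<Omega> \<longrightarrow> f x = 0"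
    by eventually_elim (auto simp: indicator_def split: if_splits)
  then show ?thesis
    using \<Omega> by (subst AE_restrict_space_iff) auto
qed

section \<open>Square integrable functions\<close>

lemma L2_measurable: "f \<in> L2 S \<Longrightarrow> f \<in> borel_measurable (lebesgue_on S)"
  by (simp add: L2_def)

lemma L2_diff:
  assumes "f \<in> L2 S" "g \<in> L2 S"
  shows "(\<lambda>x. f x - g x) \<in> L2 S"
proof -
  have "integrable (lebesgue_on S) (\<lambda>x. 2 * (norm (f x))\<^sup>2 + 2 * (norm (g x))\<^sup>2)"
    using assms by (simp add: L2_def)
  moreover have "(norm (f x - g x))\<^sup>2 \<le> 2 * (norm (f x))\<^sup>2 + 2 * (norm (g x))\<^sup>2" for x
  proof -
    have "(norm (f x - g x))\<^sup>2 \<le> (norm (f x) + norm (g x))\<^sup>2"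
      by (simp add: power_mono norm_triangle_ineq4)
    also have "\<dots> \<le> 2 * (norm (f x))\<^sup>2 + 2 * (norm (g x))\<^sup>2"
      using zero_le_power2[of "norm (f x) - norm (g x)"] by (simp add: power2_sum power2_diff)
    finally show ?thesis .
  qed
  moreover have "(\<lambda>x. f x - g x) \<in> borel_measurable (lebesgue_on S)"
    using assms by (intro borel_measurable_diff) (auto simp: L2_def)
  ultimately have "integrable (lebesgue_on S) (\<lambda>x. (norm (f x - g x))\<^sup>2)"
    by (elim Bochner_Integration.integrable_bound) (auto intro!: AE_I2)
  with \<open>_ \<in> borel_measurable _\<close> show ?thesis by (simp add: L2_def)
qed

lemma L2_inner_integrable:
  assumes "f \<in> L2 S" "g \<in> L2 S"
  shows "integrable (lebesgue_on S) (\<lambda>x. f x \<bullet> g x)"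
proof -
  have "integrable (lebesgue_on S) (\<lambda>x. (norm (f x))\<^sup>2 + (norm (g x))\<^sup>2)"
    using assms by (simp add: L2_def)
  moreover have "\<bar>f x \<bullet> g x\<bar> \<le> (norm (f x))\<^sup>2 + (norm (g x))\<^sup>2" for x
  proof -
    have "\<bar>f x \<bullet> g x\<bar> \<le> norm (f x) * norm (g x)" by (rule Cauchy_Schwarz_ineq2)
    also have "\<dots> \<le> (norm (f x))\<^sup>2 + (norm (g x))\<^sup>2"
      using zero_le_power2[of "norm (f x) - norm (g x)"] mult_nonneg_nonneg[of "norm (f x)" "norm (g x)"]
      by (simp add: power2_diff del: mult_nonneg_nonneg)
    finally show ?thesis .
  qed
  ultimately show ?thesis
    using assms by (elim Bochner_Integration.integrable_bound) (auto simp: L2_def intro!: AE_I2)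
qed

lemma L2_component:
  fixes f :: "real^'n \<Rightarrow> real^'m"
  assumes "f \<in> L2 S"
  shows "(\<lambda>x. f x $ i) \<in> L2 S"
proof -
  have m: "(\<lambda>x. f x $ i) \<in> borel_measurable (lebesgue_on S)"
    using L2_measurable[OF assms] by (rule measurable_compose) simp
  have "(norm (f x $ i))\<^sup>2 \<le> (norm (f x))\<^sup>2" for x
    by (rule power_mono) (simp_all add: component_le_norm_cart)
  moreover have "integrable (lebesgue_on S) (\<lambda>x. (norm (f x))\<^sup>2)" using assms by (simp add: L2_def)
  ultimately have "integrable (lebesgue_on S) (\<lambda>x. (norm (f x $ i))\<^sup>2)"
    using m by (elim Bochner_Integration.integrable_bound) (auto intro!: AE_I2)
  then show ?thesis using m by (simp add: L2_def)
qed

lemma L2_test_function: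
  assumes "\<Omega> \<in> lmeasurable" "\<psi> \<in> test_functions \<Omega>"
  shows "\<psi> \<in> L2 \<Omega>"
proof -
  obtain B where "\<And>x. \<bar>\<psi> x\<bar> \<le> B" by (rule test_function_bounded[OF assms(2)]) blast
  then show ?thesis
    using test_function_measurable[OF assms(2)] by (intro L2_bounded[OF assms(1), of _ B]) auto
qed

lemma L2_imp_integrable:
  fixes f :: "real^'n \<Rightarrow> real"
  assumes "S \<in> lmeasurable" "f \<in> L2 S"
  shows "integrable (lebesgue_on S) f"
proof -
  \<comment> \<open>Pairing with the constant 1, which is in \<open>L2\<close> because the measure
    is finite, turns square integrability into integrability.\<close>
  have "(\<lambda>_. 1::real) \<in> L2 S" using assms(1) by (intro L2_bounded[where B = 1]) auto
  from L2_inner_integrable[OF assms(2) this] show ?thesis by simp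
qed

section \<open>Differences of weak gradients and uniqueness\<close>

lemma has_weak_grad_diff:
  fixes \<Omega> :: "(real^'n) set"
  assumes \<Omega>: "\<Omega> \<in> lmeasurable" and u: "has_weak_grad \<Omega> u G" and w: "has_weak_grad \<Omega> w H"
  shows "has_weak_grad \<Omega> (\<lambda>x. u x - w x) (\<lambda>x. G x - H x)"
proof -
  note L2 = u[unfolded has_weak_grad_def] w[unfolded has_weak_grad_def]
  have "(\<integral>x. (u x - w x) * partial_deriv i \<psi> x \<partial>lebesgue_on \<Omega>)
      = - (\<integral>x. (G x - H x) $ i * \<psi> x \<partial>lebesgue_on \<Omega>)" if \<psi>: "\<psi> \<in> test_functions \<Omega>" for \<psi> i
  proof -
    note t = L2_test_function[OF \<Omega> \<psi>] L2_test_function[OF \<Omega> test_function_partial_deriv[OF \<psi>, of i]]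
    have "integrable (lebesgue_on \<Omega>) (\<lambda>x. u x * partial_deriv i \<psi> x)"
      "integrable (lebesgue_on \<Omega>) (\<lambda>x. w x * partial_deriv i \<psi> x)"
      "integrable (lebesgue_on \<Omega>) (\<lambda>x. G x $ i * \<psi> x)"
      "integrable (lebesgue_on \<Omega>) (\<lambda>x. H x $ i * \<psi> x)"
      using L2 t L2_inner_integrable[of u \<Omega> "partial_deriv i \<psi>"]
        L2_inner_integrable[of w \<Omega> "partial_deriv i \<psi>"]
        L2_inner_integrable[OF L2_component, of G \<Omega> \<psi> i]
        L2_inner_integrable[OF L2_component, of H \<Omega> \<psi> i] by simp_all
    moreover have "(\<integral>x. u x * partial_deriv i \<psi> x \<partial>lebesgue_on \<Omega>) = - (\<integral>x. G x $ i * \<psi> x \<partial>lebesgue_on \<Omega>)"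
      "(\<integral>x. w x * partial_deriv i \<psi> x \<partial>lebesgue_on \<Omega>) = - (\<integral>x. H x $ i * \<psi> x \<partial>lebesgue_on \<Omega>)"
      using L2 \<psi> by auto
    ultimately show ?thesis by (simp add: left_diff_distrib)
  qed
  then show ?thesis using L2 by (auto simp: has_weak_grad_def intro: L2_diff)
qed

text \<open>The difference of the two candidates is a weak gradient of the zero function, so each of
  its components is orthogonal to all test functions.\<close>

lemma has_weak_grad_unique:
  fixes \<Omega> :: "(real^'n) set"
  assumes \<Omega>: "open \<Omega>" "bounded \<Omega>" and G: "has_weak_grad \<Omega> u G" and H: "has_weak_grad \<Omega> u H"
  shows "AE x in lebesgue_on \<Omega>. G x = H x"
proof -
  have lm: "\<Omega> \<in> lmeasurable" using \<Omega> by (simp add: lmeasurable_open)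
  have zero: "has_weak_grad \<Omega> (\<lambda>x. 0) (\<lambda>x. G x - H x)"
    using has_weak_grad_diff[OF lm G H] by simp
  have "AE x in lebesgue_on \<Omega>. (G x - H x) $ i = 0" for i
  proof (rule fundamental_lemma_calculus_of_variations[OF \<Omega>(1)])
    have "(\<lambda>x. G x - H x) \<in> L2 \<Omega>" using zero by (simp add: has_weak_grad_def)
    then show "integrable (lebesgue_on \<Omega>) (\<lambda>x. (G x - H x) $ i)"
      by (intro L2_imp_integrable[OF lm] L2_component)
    show "(\<integral>x. (G x - H x) $ i * \<psi> x \<partial>lebesgue_on \<Omega>) = 0" if "\<psi> \<in> test_functions \<Omega>" for \<psi>
      using zero that unfolding has_weak_grad_def by force
  qed
  then have "AE x in lebesgue_on \<Omega>. \<forall>i\<in>UNIV. (G x - H x) $ i = 0"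
    by (intro AE_finite_allI) auto
  then show ?thesis by eventually_elim (simp add: vec_eq_iff)
qed

lemma has_weak_grad_weak_grad: "u \<in> H1 \<Omega> \<Longrightarrow> has_weak_grad \<Omega> u (weak_grad \<Omega> u)"
  unfolding H1_def weak_grad_def by (auto intro: someI[of "has_weak_grad \<Omega> u"])

text \<open>The chosen gradient on the left and the difference of chosen gradients on the right are
  two weak gradients of the same function.\<close>

lemma weak_grad_diff:
  fixes \<Omega> :: "(real^'n) set"
  assumes \<Omega>: "open \<Omega>" "bounded \<Omega>" and "u \<in> H1 \<Omega>" "w \<in> H1 \<Omega>"
  shows "AE x in lebesgue_on \<Omega>. weak_grad \<Omega> (\<lambda>x. u x - w x) x = weak_grad \<Omega> u x - weak_grad \<Omega> w x"
proof -
  have lm: "\<Omega> \<in> lmeasurable" using \<Omega> by (simp add: lmeasurable_open)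
  have d: "has_weak_grad \<Omega> (\<lambda>x. u x - w x) (\<lambda>x. weak_grad \<Omega> u x - weak_grad \<Omega> w x)"
    using assms by (intro has_weak_grad_diff[OF lm] has_weak_grad_weak_grad)
  then have "(\<lambda>x. u x - w x) \<in> H1 \<Omega>" by (auto simp: H1_def)
  then show ?thesis
    using has_weak_grad_unique[OF \<Omega> has_weak_grad_weak_grad d] by simp
qed

section \<open>The energy inequality\<close>

text \<open>Unlike \<open>L2\<close>, this class is closed under products and under composition with
  continuous functions. It contains all finite element functions and embeds into the integrable
  functions on \<Omega>, so most integrability questions reduce to the shape of the
  integrand.\<close>

definition bounded_measurable :: "(real^'n) set \<Rightarrow> (real^'n \<Rightarrow> 'b::euclidean_space) set" where
  "bounded_measurable \<Omega> =
     {f. f \<in> borel_measurable (lebesgue_on \<Omega>) \<and> (\<exists>B. \<forall>x\<in>\<Omega>. norm (f x) \<le> B)}"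

lemma bounded_measurableE:
  assumes "f \<in> bounded_measurable \<Omega>"
  obtains B where "f \<in> borel_measurable (lebesgue_on \<Omega>)" "0 \<le> B" "\<And>x. x \<in> \<Omega> \<Longrightarrow> norm (f x) \<le> B"
proof -
  obtain B where "f \<in> borel_measurable (lebesgue_on \<Omega>)" "\<forall>x\<in>\<Omega>. norm (f x) \<le> B"
    using assms by (auto simp: bounded_measurable_def)
  then show ?thesis using that[of "\<bar>B\<bar>"] by force
qed

lemma bounded_measurableI:
  "f \<in> borel_measurable (lebesgue_on \<Omega>) \<Longrightarrow> (\<And>x. x \<in> \<Omega> \<Longrightarrow> norm (f x) \<le> B) \<Longrightarrow> f \<in> bounded_measurable \<Omega>"
  by (auto simp: bounded_measurable_def)

lemma bounded_measurable_continuous: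
  assumes "open \<Omega>" "bounded \<Omega>" "continuous_on (closure \<Omega>) f"
  shows "f \<in> bounded_measurable \<Omega>"
proof -
  have "bounded (f ` closure \<Omega>)"
    using assms by (intro compact_imp_bounded compact_continuous_image) simp_all
  then obtain B where "\<And>x. x \<in> closure \<Omega> \<Longrightarrow> norm (f x) \<le> B"
    by (auto simp: bounded_iff)
  moreover have "f \<in> borel_measurable (lebesgue_on \<Omega>)"
    using assms(1) continuous_on_subset[OF assms(3) closure_subset]
    by (intro continuous_imp_measurable_on_sets_lebesgue) simp_all
  ultimately show ?thesis
    using closure_subset[of \<Omega>] by (intro bounded_measurableI[where B = B]) auto
qed

text \<open>Measurability and local boundedness replace continuity of \<open>h\<close> with a view
  to \<open>deriv Fp\<close> and \<open>deriv Fm\<close>: the first comes from monotonicity, the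
  second from the growth bounds.\<close>

lemma bounded_measurable_compose:
  fixes h :: "real \<Rightarrow> real"
  assumes u: "u \<in> bounded_measurable \<Omega>" and h: "h \<in> borel_measurable borel"
    and bounded: "\<And>R. \<exists>B. \<forall>s. \<bar>s\<bar> \<le> R \<longrightarrow> \<bar>h s\<bar> \<le> B"
  shows "(\<lambda>x. h (u x)) \<in> bounded_measurable \<Omega>"
proof -
  obtain R where R: "u \<in> borel_measurable (lebesgue_on \<Omega>)" "\<And>x. x \<in> \<Omega> \<Longrightarrow> norm (u x) \<le> R"
    using u by (rule bounded_measurableE) blast
  obtain B where "\<And>s. \<bar>s\<bar> \<le> R \<Longrightarrow> \<bar>h s\<bar> \<le> B" using bounded by blast
  then show ?thesis
    using R measurable_compose[OF R(1) h] by (intro bounded_measurableI[where B = B]) simp_all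
qed

lemma bounded_measurable_compose_continuous:
  fixes h :: "real \<Rightarrow> real"
  assumes "u \<in> bounded_measurable \<Omega>" "continuous_on UNIV h"
  shows "(\<lambda>x. h (u x)) \<in> bounded_measurable \<Omega>"
proof (rule bounded_measurable_compose[OF assms(1) borel_measurable_continuous_onI[OF assms(2)]])
  fix R :: real
  have "bounded (h ` {-R..R})"
    by (intro compact_imp_bounded compact_continuous_image continuous_on_subset[OF assms(2)]) simp_all
  then obtain B where "\<And>s. s \<in> {-R..R} \<Longrightarrow> \<bar>h s\<bar> \<le> B"
    unfolding bounded_iff by (metis imageI real_norm_def)
  moreover have "s \<in> {-R..R}" if "\<bar>s\<bar> \<le> R" for s
    using that by (simp add: abs_le_iff)
  ultimately show "\<exists>B. \<forall>s. \<bar>s\<bar> \<le> R \<longrightarrow> \<bar>h s\<bar> \<le> B" by blast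
qed

lemma bounded_measurable_diff:
  assumes "f \<in> bounded_measurable \<Omega>" "g \<in> bounded_measurable \<Omega>"
  shows "(\<lambda>x. f x - g x) \<in> bounded_measurable \<Omega>"
proof -
  obtain B C where B: "f \<in> borel_measurable (lebesgue_on \<Omega>)" "\<And>x. x \<in> \<Omega> \<Longrightarrow> norm (f x) \<le> B"
    and C: "g \<in> borel_measurable (lebesgue_on \<Omega>)" "\<And>x. x \<in> \<Omega> \<Longrightarrow> norm (g x) \<le> C"
    using assms by (metis bounded_measurableE)
  have "norm (f x - g x) \<le> B + C" if "x \<in> \<Omega>" for x
    using norm_triangle_ineq4[of "f x" "g x"] B(2)[OF that] C(2)[OF that] by simp
  then show ?thesis
    using borel_measurable_diff[OF B(1) C(1)] by (intro bounded_measurableI)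
qed

lemma bounded_measurable_add:
  assumes "f \<in> bounded_measurable \<Omega>" "g \<in> bounded_measurable \<Omega>"
  shows "(\<lambda>x. f x + g x) \<in> bounded_measurable \<Omega>"
proof -
  obtain B C where B: "f \<in> borel_measurable (lebesgue_on \<Omega>)" "\<And>x. x \<in> \<Omega> \<Longrightarrow> norm (f x) \<le> B"
    and C: "g \<in> borel_measurable (lebesgue_on \<Omega>)" "\<And>x. x \<in> \<Omega> \<Longrightarrow> norm (g x) \<le> C"
    using assms by (metis bounded_measurableE)
  have "norm (f x + g x) \<le> B + C" if "x \<in> \<Omega>" for x
    using norm_triangle_ineq[of "f x" "g x"] B(2)[OF that] C(2)[OF that] by simp
  then show ?thesis
    using borel_measurable_add[OF B(1) C(1)] by (intro bounded_measurableI)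
qed

lemma bounded_measurable_mult:
  fixes f g :: "real^'n \<Rightarrow> real"
  assumes "f \<in> bounded_measurable \<Omega>" "g \<in> bounded_measurable \<Omega>"
  shows "(\<lambda>x. f x * g x) \<in> bounded_measurable \<Omega>"
proof -
  obtain B C where B: "f \<in> borel_measurable (lebesgue_on \<Omega>)" "\<And>x. x \<in> \<Omega> \<Longrightarrow> norm (f x) \<le> B" "0 \<le> B"
    and C: "g \<in> borel_measurable (lebesgue_on \<Omega>)" "\<And>x. x \<in> \<Omega> \<Longrightarrow> norm (g x) \<le> C"
    using assms by (metis bounded_measurableE)
  have "norm (f x * g x) \<le> B * C" if "x \<in> \<Omega>" for x
    unfolding norm_mult using B(2)[OF that] C(2)[OF that] B(3) by (intro mult_mono) simp_all
  then show ?thesis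
    using borel_measurable_times[OF B(1) C(1)] by (intro bounded_measurableI)
qed

lemma bounded_measurable_norm_square:
  assumes "f \<in> bounded_measurable \<Omega>"
  shows "(\<lambda>x. (norm (f x))\<^sup>2) \<in> bounded_measurable \<Omega>"
proof -
  obtain B where B: "f \<in> borel_measurable (lebesgue_on \<Omega>)" "\<And>x. x \<in> \<Omega> \<Longrightarrow> norm (f x) \<le> B"
    using assms by (rule bounded_measurableE) blast
  have "norm ((norm (f x))\<^sup>2) \<le> B\<^sup>2" if "x \<in> \<Omega>" for x
    using B(2)[OF that] by (simp add: power_mono)
  moreover have "(\<lambda>x. (norm (f x))\<^sup>2) \<in> borel_measurable (lebesgue_on \<Omega>)"
    using B(1) by simp
  ultimately show ?thesis by (intro bounded_measurableI)
qed

lemma bounded_measurable_L2: "\<Omega> \<in> lmeasurable \<Longrightarrow> f \<in> bounded_measurable \<Omega> \<Longrightarrow> f \<in> L2 \<Omega>"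
  by (elim bounded_measurableE) (rule L2_bounded)

lemma bounded_measurable_integrable:
  "\<Omega> \<in> lmeasurable \<Longrightarrow> f \<in> bounded_measurable \<Omega> \<Longrightarrow> integrable (lebesgue_on \<Omega>) f"
  by (elim bounded_measurableE) (rule integrable_bounded_lebesgue_on)

lemma L2_scaleR_bounded:
  fixes f :: "real^'n \<Rightarrow> real"
  assumes f: "f \<in> bounded_measurable \<Omega>" and g: "g \<in> L2 \<Omega>"
  shows "(\<lambda>x. f x *\<^sub>R g x) \<in> L2 \<Omega>"
proof -
  obtain B where B: "f \<in> borel_measurable (lebesgue_on \<Omega>)" "\<And>x. x \<in> \<Omega> \<Longrightarrow> norm (f x) \<le> B" "0 \<le> B"
    using f by (rule bounded_measurableE) blast
  have m: "(\<lambda>x. f x *\<^sub>R g x) \<in> borel_measurable (lebesgue_on \<Omega>)"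
    using B(1) L2_measurable[OF g] by (rule borel_measurable_scaleR)
  have "integrable (lebesgue_on \<Omega>) (\<lambda>x. B\<^sup>2 * (norm (g x))\<^sup>2)"
    using g by (simp add: L2_def)
  then have "integrable (lebesgue_on \<Omega>) (\<lambda>x. (norm (f x *\<^sub>R g x))\<^sup>2)"
  proof (rule Bochner_Integration.integrable_bound)
    show "AE x in lebesgue_on \<Omega>. norm ((norm (f x *\<^sub>R g x))\<^sup>2) \<le> norm (B\<^sup>2 * (norm (g x))\<^sup>2)"
    proof (rule AE_I2)
      fix x assume "x \<in> space (lebesgue_on \<Omega>)"
      then have "(norm (f x))\<^sup>2 \<le> B\<^sup>2" using B(2)[of x] by (intro power_mono) simp_all
      then show "norm ((norm (f x *\<^sub>R g x))\<^sup>2) \<le> norm (B\<^sup>2 * (norm (g x))\<^sup>2)"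
        by (simp add: power_mult_distrib mult_right_mono)
    qed
  qed (use m in \<open>simp del: norm_scaleR\<close>)
  with m show ?thesis by (simp add: L2_def)
qed

section \<open>Finite element functions and tangents of convex functions\<close>

lemma fe_space_diff:
  assumes "u \<in> fe_space \<Omega> \<T> j" "w \<in> fe_space \<Omega> \<T> j"
  shows "(\<lambda>x. u x - w x) \<in> fe_space \<Omega> \<T> j"
proof -
  have "\<exists>p\<in>polynomials_upto j. \<forall>x\<in>T. u x - w x = p x" if T: "T \<in> \<T>" for T
  proof -
    obtain p r where p: "p \<in> polynomials_upto j" "\<forall>x\<in>T. u x = p x"
      and r: "r \<in> polynomials_upto j" "\<forall>x\<in>T. w x = r x"
      using assms T unfolding fe_space_def by blast
    obtain c d where
      c: "\<forall>x. p x = (\<Sum>\<alpha> | (\<Sum>i\<in>UNIV. \<alpha> i) \<le> j. c \<alpha> * (\<Prod>i\<in>UNIV. x $ i ^ \<alpha> i))"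
      and d: "\<forall>x. r x = (\<Sum>\<alpha> | (\<Sum>i\<in>UNIV. \<alpha> i) \<le> j. d \<alpha> * (\<Prod>i\<in>UNIV. x $ i ^ \<alpha> i))"
      using p(1) r(1) unfolding polynomials_upto_def by blast
    have "(\<lambda>x. p x - r x) \<in> polynomials_upto j"
      unfolding polynomials_upto_def
      by (intro CollectI exI[of _ "\<lambda>\<alpha>. c \<alpha> - d \<alpha>"] allI) (simp add: c d left_diff_distrib sum_subtractf)
    then show ?thesis using p(2) r(2) by (intro bexI) simp_all
  qed
  then show ?thesis using assms by (auto simp: fe_space_def intro: continuous_on_diff)
qed

lemma Hdiv_continuous_on:
  assumes "v \<in> Hdiv \<Omega> \<T>"
  shows "continuous_on (closure \<Omega>) v"
proof -
  have "continuous_on (closure \<Omega>) (\<lambda>x. \<chi> i. v x $ i)"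
    using assms by (intro continuous_on_vec_lambda) (auto simp: Hdiv_def fe_space_def)
  then show ?thesis by simp
qed

lemma convex_on_above_tangent_UNIV:
  fixes f :: "real \<Rightarrow> real"
  assumes "convex_on UNIV f" "f field_differentiable (at a)"
  shows "deriv f a * (b - a) \<le> f b - f a"
  using assms by (intro convex_on_imp_above_tangent[where A = UNIV])
    (simp_all add: DERIV_deriv_iff_field_differentiable)

text \<open>Adding the tangent inequalities at two points shows that the derivative is monotone, and
  monotone functions are Borel.\<close>

lemma convex_on_deriv_measurable:
  fixes f :: "real \<Rightarrow> real"
  assumes "convex_on UNIV f" "\<And>s. f field_differentiable (at s)"
  shows "deriv f \<in> borel_measurable borel"
proof (rule borel_measurable_mono, rule monoI)
  fix a b :: real assume "a \<le> b"
  have "(deriv f a - deriv f b) * (b - a) \<le> 0"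
    using convex_on_above_tangent_UNIV[OF assms, of a b] convex_on_above_tangent_UNIV[OF assms, of b a]
    by (simp add: algebra_simps)
  then show "deriv f a \<le> deriv f b"
    using \<open>a \<le> b\<close> by (cases "a = b") (auto simp: mult_le_0_iff)
qed

theorem theorem3:
  fixes \<Omega> :: "(real^'n) set"
    and \<T> :: "nat \<Rightarrow> (real^'n) set set"
    and P :: "nat \<Rightarrow> (real^'n \<Rightarrow> real) \<Rightarrow> real^'n \<Rightarrow> real"
    and g :: "real^'n \<Rightarrow> real^'n"
    and \<sigma> \<epsilon> \<tau> :: real
    and \<rho> \<eta> m :: "real \<Rightarrow> real"
    and \<rho>_lo \<rho>_hi \<eta>_lo \<eta>_hi m_lo m_hi \<rho>1 \<rho>2 :: real
    and F Fp Fm :: "real \<Rightarrow> real"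
    and C q :: real
    and G :: "(real^'n \<Rightarrow> real) \<Rightarrow> (real^'n \<Rightarrow> real) \<Rightarrow> (real^'n \<Rightarrow> real) \<Rightarrow> real"
    and k :: nat
    and \<phi>_old \<phi> \<mu> \<phi>_new \<mu>_new :: "real^'n \<Rightarrow> real"
    and v v_new :: "real^'n \<Rightarrow> real^'n"
  assumes dim: "CARD('n) = 2 \<or> CARD('n) = 3"
    and domain: "open \<Omega>" "connected \<Omega>" "\<Omega> \<noteq> {}" "bounded \<Omega>"
    and mesh: "\<And>j. conforming_mesh \<Omega> (\<T> j)"
    and proj: "\<And>j. stable_projection \<Omega> (\<T> j) (P j)"
    and params: "\<sigma> > 0" "\<epsilon> > 0" "\<tau> > 0"
    and force: "g \<in> L2 \<Omega>"
    and rho_bounds: "continuous_on UNIV \<rho>" "\<rho>_lo > 0" "\<And>s. \<rho>_lo \<le> \<rho> s \<and> \<rho> s \<le> \<rho>_hi"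
    and eta_bounds: "continuous_on UNIV \<eta>" "\<eta>_lo > 0" "\<And>s. \<eta>_lo \<le> \<eta> s \<and> \<eta> s \<le> \<eta>_hi"
    and m_bounds: "continuous_on UNIV m" "m_lo > 0" "\<And>s. m_lo \<le> m s \<and> m s \<le> m_hi"
    and rho_smooth: "\<And>j s. ((deriv ^^ j) \<rho>) field_differentiable (at s)"
    and rho_mono: "mono \<rho>"
    and rho_consts: "0 < \<rho>1" "\<rho>1 \<le> \<rho>2"
    and rho_affine: "\<rho>1 < \<rho>2 \<Longrightarrow>
          (\<forall>s. \<bar>s\<bar> < 1 + \<rho>1 / (\<rho>2 - \<rho>1) \<longrightarrow> \<rho> s = (\<rho>2 - \<rho>1) / 2 * s + (\<rho>1 + \<rho>2) / 2)"
    and rho_right: "\<rho>1 < \<rho>2 \<Longrightarrow> \<rho> constant_on {s. s > 1 + 2 * \<rho>1 / (\<rho>2 - \<rho>1)}"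
    and rho_left: "\<rho>1 < \<rho>2 \<Longrightarrow> \<rho> constant_on {s. s < - 1 - 2 * \<rho>1 / (\<rho>2 - \<rho>1)}"
    and rho_const: "\<rho>1 = \<rho>2 \<Longrightarrow> \<rho> constant_on UNIV"
    and F_split: "\<And>s. F s = Fp s + Fm s"
    and F_C1: "\<And>s. F field_differentiable (at s)" "continuous_on UNIV (deriv F)"
    and Fp: "convex_on UNIV Fp" "\<And>s. Fp field_differentiable (at s)"
    and Fm: "concave_on UNIV Fm" "\<And>s. Fm field_differentiable (at s)"
    and growth_consts: "C > 0" "q \<ge> 1" "CARD('n) = 3 \<Longrightarrow> q \<le> 4"
    and F_growth: "\<And>s. \<bar>F s\<bar> \<le> C * (1 + \<bar>s\<bar> powr q)"
    and Fp_growth: "\<And>s. \<bar>deriv Fp s\<bar> \<le> C * (1 + \<bar>s\<bar> powr (q - 1))"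
    and Fm_growth: "\<And>s. \<bar>deriv Fm s\<bar> \<le> C * (1 + \<bar>s\<bar> powr (q - 1))"
    and Fp_operator: "\<And>u w. u \<in> H1 \<Omega> \<Longrightarrow> w \<in> H1 \<Omega> \<Longrightarrow>
          integrable (lebesgue_on \<Omega>) (\<lambda>x. deriv Fp (u x) * w x)"
    and Fp_newton: "newton_derivative \<Omega> (\<lambda>u w. L2_inner \<Omega> (\<lambda>x. deriv Fp (u x)) w) G"
    and G_nonneg: "\<And>u w. u \<in> H1 \<Omega> \<Longrightarrow> w \<in> H1 \<Omega> \<Longrightarrow> G u w w \<ge> 0"
    and k: "k \<ge> 1"
    and data: "\<phi>_old \<in> fe_space \<Omega> (\<T> (k - 1)) 1" "\<phi> \<in> fe_space \<Omega> (\<T> k) 1"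
          "\<mu> \<in> fe_space \<Omega> (\<T> k) 1" "v \<in> Hdiv \<Omega> (\<T> k)"
    and solution: "v_new \<in> Hdiv \<Omega> (\<T> (k + 1))" "\<phi>_new \<in> fe_space \<Omega> (\<T> (k + 1)) 1"
          "\<mu>_new \<in> fe_space \<Omega> (\<T> (k + 1)) 1"
    and momentum: "\<And>w. w \<in> Hdiv \<Omega> (\<T> (k + 1)) \<Longrightarrow>
          1 / (2 * \<tau>) * L2_inner \<Omega>
            (\<lambda>x. \<rho> (\<phi> x) *\<^sub>R v_new x - \<rho> (\<phi>_old x) *\<^sub>R v x + \<rho> (\<phi>_old x) *\<^sub>R (v_new x - v x)) w
          + trilinear_form \<Omega>
              (\<lambda>x. \<rho> (\<phi> x) *\<^sub>R v x + (- deriv \<rho> (\<phi> x) * m (\<phi> x)) *\<^sub>R weak_grad \<Omega> \<mu> x) v_new w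
          + L2_inner \<Omega> (\<lambda>x. (2 * \<eta> (\<phi> x)) *\<^sub>R sym_grad \<Omega> v_new x) (sym_grad \<Omega> w)
          - L2_inner \<Omega> (\<lambda>x. \<mu>_new x *\<^sub>R weak_grad \<Omega> \<phi> x + \<rho> (\<phi> x) *\<^sub>R g x) w = 0"
    and phase: "\<And>\<Phi>. \<Phi> \<in> fe_space \<Omega> (\<T> (k + 1)) 1 \<Longrightarrow>
          1 / \<tau> * L2_inner \<Omega> (\<lambda>x. \<phi>_new x - P (k + 1) \<phi> x) \<Phi>
          + L2_inner \<Omega> (\<lambda>x. m (\<phi> x) *\<^sub>R weak_grad \<Omega> \<mu>_new x) (weak_grad \<Omega> \<Phi>)
          + L2_inner \<Omega> (\<lambda>x. v_new x \<bullet> weak_grad \<Omega> \<phi> x) \<Phi> = 0"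
    and potential: "\<And>\<Psi>. \<Psi> \<in> fe_space \<Omega> (\<T> (k + 1)) 1 \<Longrightarrow>
          \<sigma> * \<epsilon> * L2_inner \<Omega> (weak_grad \<Omega> \<phi>_new) (weak_grad \<Omega> \<Psi>)
          + L2_inner \<Omega> (\<lambda>x. deriv Fp (\<phi>_new x) + deriv Fm (P (k + 1) \<phi> x)) \<Psi>
          - L2_inner \<Omega> \<mu>_new \<Psi> = 0"
  shows "1/2 * (\<integral>x. \<rho> (\<phi> x) * (norm (v_new x))\<^sup>2 \<partial>lebesgue_on \<Omega>)
       + \<sigma> * \<epsilon> / 2 * (\<integral>x. (norm (weak_grad \<Omega> \<phi>_new x))\<^sup>2 \<partial>lebesgue_on \<Omega>)
       + (\<integral>x. F (\<phi>_new x) \<partial>lebesgue_on \<Omega>)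
       + 1/2 * (\<integral>x. \<rho> (\<phi>_old x) * (norm (v_new x - v x))\<^sup>2 \<partial>lebesgue_on \<Omega>)
       + \<sigma> * \<epsilon> / 2 *
           (\<integral>x. (norm (weak_grad \<Omega> \<phi>_new x - weak_grad \<Omega> (P (k + 1) \<phi>) x))\<^sup>2 \<partial>lebesgue_on \<Omega>)
       + \<tau> * (\<integral>x. 2 * \<eta> (\<phi> x) * (norm (sym_grad \<Omega> v_new x))\<^sup>2 \<partial>lebesgue_on \<Omega>)
       + \<tau> * (\<integral>x. m (\<phi> x) * (norm (weak_grad \<Omega> \<mu>_new x))\<^sup>2 \<partial>lebesgue_on \<Omega>)
     \<le> 1/2 * (\<integral>x. \<rho> (\<phi>_old x) * (norm (v x))\<^sup>2 \<partial>lebesgue_on \<Omega>)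
       + \<sigma> * \<epsilon> / 2 * (\<integral>x. (norm (weak_grad \<Omega> (P (k + 1) \<phi>) x))\<^sup>2 \<partial>lebesgue_on \<Omega>)
       + (\<integral>x. F (P (k + 1) \<phi> x) \<partial>lebesgue_on \<Omega>)
       + \<tau> * (\<integral>x. \<rho> (\<phi> x) * (g x \<bullet> v_new x) \<partial>lebesgue_on \<Omega>)"
proof -
  define M where "M = lebesgue_on \<Omega>"
  define \<psi> where "\<psi> = P (k + 1) \<phi>"
  \<comment> \<open>Both terms belong to the new mesh, so this difference may be inserted into the
    potential equation; it is also the increment in the phase equation.\<close>
  define \<delta> where "\<delta> x = \<phi>_new x - \<psi> x" for x
  have lm: "\<Omega> \<in> lmeasurable" using domain by (simp add: lmeasurable_open)
  note fe_H1 = fe_space_subset_H1[OF domain(1,4) mesh]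
  have \<phi>_H1: "\<phi> \<in> H1 \<Omega>" using data(2) by (rule fe_H1)
  have \<psi>_fe: "\<psi> \<in> fe_space \<Omega> (\<T> (k + 1)) 1"
    using proj[of "k + 1"] \<phi>_H1 by (simp add: stable_projection_def \<psi>_def)
  have \<delta>_fe: "\<delta> \<in> fe_space \<Omega> (\<T> (k + 1)) 1"
    unfolding \<delta>_def[abs_def] using solution(2) \<psi>_fe by (rule fe_space_diff)
  have fe_bm: "u \<in> bounded_measurable \<Omega>" if "u \<in> fe_space \<Omega> (\<T> i) j" for u i j
    using that domain by (intro bounded_measurable_continuous) (simp_all add: fe_space_def)
  have Hdiv_bm: "w \<in> bounded_measurable \<Omega>" if "w \<in> Hdiv \<Omega> (\<T> i)" for w i
    using Hdiv_continuous_on[OF that] domain by (intro bounded_measurable_continuous)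
  note bm = fe_bm[OF data(1)] fe_bm[OF data(2)] fe_bm[OF solution(2)] fe_bm[OF solution(3)]
    fe_bm[OF \<psi>_fe] fe_bm[OF \<delta>_fe] Hdiv_bm[OF data(4)] Hdiv_bm[OF solution(1)]
  note int_bm = bounded_measurable_integrable[OF lm]
  have \<rho>_bm: "(\<lambda>x. \<rho> (\<phi> x)) \<in> bounded_measurable \<Omega>" "(\<lambda>x. \<rho> (\<phi>_old x)) \<in> bounded_measurable \<Omega>"
    using bm rho_bounds(1) by (auto intro: bounded_measurable_compose_continuous)
  have grad_L2: "weak_grad \<Omega> u \<in> L2 \<Omega>" if "u \<in> fe_space \<Omega> (\<T> i) j" for u i j
    using has_weak_grad_weak_grad[OF fe_H1[OF that]] by (simp add: has_weak_grad_def)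

  \<comment> \<open>\<open>X\<close> couples momentum with phase and \<open>Z\<close> couples phase
    with potential; both will cancel. \<open>W\<close> is the tested potential derivative. The
    \<open>I\<close> quantities are numbered by their position in the claim; the third place belongs
    to the integral of \<open>F (\<phi>_new x)\<close>, which stays written out.\<close>
  define X where "X = (\<integral>x. \<mu>_new x * (v_new x \<bullet> weak_grad \<Omega> \<phi> x) \<partial>M)"
  define Z where "Z = (\<integral>x. \<delta> x * \<mu>_new x \<partial>M)"
  define W where "W = (\<integral>x. (deriv Fp (\<phi>_new x) + deriv Fm (\<psi> x)) * \<delta> x \<partial>M)"
  define I1 where "I1 = (\<integral>x. \<rho> (\<phi> x) * (norm (v_new x))\<^sup>2 \<partial>M)"
  define I2 where "I2 = (\<integral>x. (norm (weak_grad \<Omega> \<phi>_new x))\<^sup>2 \<partial>M)"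
  define I4 where "I4 = (\<integral>x. \<rho> (\<phi>_old x) * (norm (v_new x - v x))\<^sup>2 \<partial>M)"
  define I5 where "I5 = (\<integral>x. (norm (weak_grad \<Omega> \<phi>_new x - weak_grad \<Omega> \<psi> x))\<^sup>2 \<partial>M)"
  define I6 where "I6 = (\<integral>x. 2 * \<eta> (\<phi> x) * (norm (sym_grad \<Omega> v_new x))\<^sup>2 \<partial>M)"
  define I7 where "I7 = (\<integral>x. m (\<phi> x) * (norm (weak_grad \<Omega> \<mu>_new x))\<^sup>2 \<partial>M)"
  define I8 where "I8 = (\<integral>x. \<rho> (\<phi>_old x) * (norm (v x))\<^sup>2 \<partial>M)"
  define I9 where "I9 = (\<integral>x. (norm (weak_grad \<Omega> \<psi> x))\<^sup>2 \<partial>M)"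
  define Y where "Y = (\<integral>x. \<rho> (\<phi> x) * (g x \<bullet> v_new x) \<partial>M)"

  have inertia: "L2_inner \<Omega>
      (\<lambda>x. \<rho> (\<phi> x) *\<^sub>R v_new x - \<rho> (\<phi>_old x) *\<^sub>R v x + \<rho> (\<phi>_old x) *\<^sub>R (v_new x - v x)) v_new
      = I1 + I4 - I8"
  proof -
    \<comment> \<open>The two terms weighted by \<open>\<rho> (\<phi>_old x)\<close> contribute
      |v_new|^2 - 2 v . v_new, which is completed to |v_new - v|^2 - |v|^2.\<close>
    have "(\<rho> (\<phi> x) *\<^sub>R v_new x - \<rho> (\<phi>_old x) *\<^sub>R v x + \<rho> (\<phi>_old x) *\<^sub>R (v_new x - v x)) \<bullet> v_new x
      = \<rho> (\<phi> x) * (norm (v_new x))\<^sup>2 + \<rho> (\<phi>_old x) * (norm (v_new x - v x))\<^sup>2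
        - \<rho> (\<phi>_old x) * (norm (v x))\<^sup>2" for x
      by (simp add: power2_norm_eq_inner inner_diff_left inner_diff_right inner_add_left
          inner_commute[of "v_new x" "v x"] right_diff_distrib distrib_left)
    moreover have "integrable M (\<lambda>x. \<rho> (\<phi> x) * (norm (v_new x))\<^sup>2)"
      "integrable M (\<lambda>x. \<rho> (\<phi>_old x) * (norm (v_new x - v x))\<^sup>2)"
      "integrable M (\<lambda>x. \<rho> (\<phi>_old x) * (norm (v x))\<^sup>2)"
      unfolding M_def using bm \<rho>_bm
      by (auto intro!: int_bm bounded_measurable_mult bounded_measurable_norm_square bounded_measurable_diff)
    ultimately show ?thesis
      by (simp add: L2_inner_def I1_def I4_def I8_def M_def)
  qed
  have viscous: "L2_inner \<Omega> (\<lambda>x. (2 * \<eta> (\<phi> x)) *\<^sub>R sym_grad \<Omega> v_new x) (sym_grad \<Omega> v_new) = I6"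
    by (simp add: L2_inner_def I6_def M_def power2_norm_eq_inner)
  have forces: "L2_inner \<Omega> (\<lambda>x. \<mu>_new x *\<^sub>R weak_grad \<Omega> \<phi> x + \<rho> (\<phi> x) *\<^sub>R g x) v_new = X + Y"
  proof -
    have "(\<mu>_new x *\<^sub>R weak_grad \<Omega> \<phi> x + \<rho> (\<phi> x) *\<^sub>R g x) \<bullet> v_new x
      = \<mu>_new x * (v_new x \<bullet> weak_grad \<Omega> \<phi> x) + \<rho> (\<phi> x) * (g x \<bullet> v_new x)" for x
      by (simp add: inner_add_left inner_commute[of "weak_grad \<Omega> \<phi> x" "v_new x"])
    moreover have "integrable M (\<lambda>x. \<mu>_new x * (v_new x \<bullet> weak_grad \<Omega> \<phi> x))"
      using L2_inner_integrable[OF bounded_measurable_L2[OF lm bm(8)] L2_scaleR_bounded[OF bm(4) grad_L2[OF data(2)]]]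
      by (simp add: M_def)
    moreover have "integrable M (\<lambda>x. \<rho> (\<phi> x) * (g x \<bullet> v_new x))"
      using L2_inner_integrable[OF L2_scaleR_bounded[OF \<rho>_bm(1) force] bounded_measurable_L2[OF lm bm(8)]]
      by (simp add: M_def)
    ultimately show ?thesis by (simp add: L2_inner_def X_def Y_def M_def)
  qed
  \<comment> \<open>With \<open>w = v_new\<close> the two integrals of \<open>trilinear_form\<close>
    are the same term, so the convective contribution cancels by definition.\<close>
  have "1 / (2 * \<tau>) * (I1 + I4 - I8) + I6 - (X + Y) = 0"
    using momentum[OF solution(1)] unfolding inertia viscous forces by (simp add: trilinear_form_def)
  then have kinetic: "1/2 * (I1 + I4 - I8) + \<tau> * I6 - \<tau> * X - \<tau> * Y = 0"
    using params(3) by (simp add: field_simps)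

  have "1 / \<tau> * Z + I7 + X = 0"
    using phase[OF solution(3)]
    by (simp add: L2_inner_def Z_def I7_def X_def M_def \<delta>_def \<psi>_def power2_norm_eq_inner mult.commute)
  then have mass: "Z + \<tau> * I7 + \<tau> * X = 0"
    using params(3) by (simp add: field_simps)

  have gradients: "L2_inner \<Omega> (weak_grad \<Omega> \<phi>_new) (weak_grad \<Omega> \<delta>) = 1/2 * (I2 + I5 - I9)"
  proof -
    \<comment> \<open>\<open>weak_grad\<close> applied to the difference is an independent choice,
      so it matches the difference of the chosen gradients only almost everywhere. This is the one
      place where the uniqueness result enters.\<close>
    have \<delta>_grad: "AE x in M. weak_grad \<Omega> \<delta> x = weak_grad \<Omega> \<phi>_new x - weak_grad \<Omega> \<psi> x"
      unfolding M_def \<delta>_def[abs_def] using domain(1,4) fe_H1[OF solution(2)] fe_H1[OF \<psi>_fe]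
      by (rule weak_grad_diff)
    have polarization: "a \<bullet> (a - b) = 1/2 * ((norm a)\<^sup>2 + (norm (a - b))\<^sup>2 - (norm b)\<^sup>2)"
      for a b :: "real^'n"
      by (simp add: power2_norm_eq_inner inner_diff_left inner_diff_right inner_commute[of b a])
    note L2 = grad_L2[OF solution(2)] grad_L2[OF \<psi>_fe] grad_L2[OF \<delta>_fe]
    have "L2_inner \<Omega> (weak_grad \<Omega> \<phi>_new) (weak_grad \<Omega> \<delta>)
      = (\<integral>x. 1/2 * ((norm (weak_grad \<Omega> \<phi>_new x))\<^sup>2 + (norm (weak_grad \<Omega> \<phi>_new x - weak_grad \<Omega> \<psi> x))\<^sup>2
          - (norm (weak_grad \<Omega> \<psi> x))\<^sup>2) \<partial>M)"
      unfolding L2_inner_def M_def[symmetric]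
    proof (rule integral_cong_AE)
      show "AE x in M. weak_grad \<Omega> \<phi>_new x \<bullet> weak_grad \<Omega> \<delta> x
        = 1/2 * ((norm (weak_grad \<Omega> \<phi>_new x))\<^sup>2 + (norm (weak_grad \<Omega> \<phi>_new x - weak_grad \<Omega> \<psi> x))\<^sup>2
          - (norm (weak_grad \<Omega> \<psi> x))\<^sup>2)"
        using \<delta>_grad by eventually_elim (simp only: polarization)
    qed (use L2_measurable[OF L2(1)] L2_measurable[OF L2(2)] L2_measurable[OF L2(3)] in
      \<open>simp_all add: M_def\<close>)
    also have "\<dots> = 1/2 * (I2 + I5 - I9)"
      using L2(1,2) L2_diff[OF L2(1,2)] unfolding I2_def I5_def I9_def M_def
      by (simp add: L2_def)
    finally show ?thesis .
  qed
  have interface: "\<sigma> * \<epsilon> * (1/2 * (I2 + I5 - I9)) + W - Z = 0"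
    using potential[OF \<delta>_fe] unfolding gradients
    by (simp add: L2_inner_def W_def Z_def M_def \<psi>_def mult.commute)

  have cont_F: "continuous_on UNIV F"
    using F_C1(1) by (intro continuous_at_imp_continuous_on ballI field_differentiable_imp_continuous_at)
  have deriv_bounded: "\<exists>B. \<forall>s. \<bar>s\<bar> \<le> R \<longrightarrow> \<bar>f s\<bar> \<le> B"
    if f: "\<And>s. \<bar>f s\<bar> \<le> C * (1 + \<bar>s\<bar> powr (q - 1))" for f :: "real \<Rightarrow> real" and R
  proof (intro exI allI impI)
    fix s :: real assume "\<bar>s\<bar> \<le> R"
    \<comment> \<open>The exponent is nonnegative because \<open>q \<ge> 1\<close>, so the growth
      bound is largest at the end of the range.\<close>
    then have "\<bar>s\<bar> powr (q - 1) \<le> R powr (q - 1)"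
      using growth_consts(2) by (intro powr_mono2) simp_all
    then have "C * (1 + \<bar>s\<bar> powr (q - 1)) \<le> C * (1 + R powr (q - 1))"
      using growth_consts(1) by simp
    with f[of s] show "\<bar>f s\<bar> \<le> C * (1 + R powr (q - 1))" by simp
  qed
  \<comment> \<open>The concave part is handled through its negative: tangents of
    \<open>- Fm\<close> at the projected phase bound \<open>Fm\<close> from above, and its monotone
    derivative supplies measurability.\<close>
  have Fm_neg: "convex_on UNIV (\<lambda>s. - Fm s)" "(\<lambda>s. - Fm s) field_differentiable (at s)"
    "deriv (\<lambda>s. - Fm s) = (\<lambda>s. - deriv Fm s)" for s
    using Fm by (auto simp: concave_on_def intro: field_differentiable_minus)
  have Fm_meas: "deriv Fm \<in> borel_measurable borel"
    using convex_on_deriv_measurable[OF Fm_neg(1,2)] by (simp add: Fm_neg(3))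
  have W_int: "(\<lambda>x. (deriv Fp (\<phi>_new x) + deriv Fm (\<psi> x)) * \<delta> x) \<in> bounded_measurable \<Omega>"
    by (intro bounded_measurable_mult bounded_measurable_add bm(6)
      bounded_measurable_compose[OF bm(3) convex_on_deriv_measurable[OF Fp] deriv_bounded[OF Fp_growth]]
      bounded_measurable_compose[OF bm(5) Fm_meas deriv_bounded[OF Fm_growth]])
  note F_bm = bounded_measurable_compose_continuous[OF bm(3) cont_F]
    bounded_measurable_compose_continuous[OF bm(5) cont_F]
  have "F (\<phi>_new x) - F (\<psi> x) \<le> (deriv Fp (\<phi>_new x) + deriv Fm (\<psi> x)) * \<delta> x" for x
  proof -
    have "Fp (\<phi>_new x) - Fp (\<psi> x) \<le> deriv Fp (\<phi>_new x) * \<delta> x"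
      using convex_on_above_tangent_UNIV[OF Fp, of "\<phi>_new x" "\<psi> x"] by (simp add: \<delta>_def algebra_simps)
    moreover have "Fm (\<phi>_new x) - Fm (\<psi> x) \<le> deriv Fm (\<psi> x) * \<delta> x"
      using convex_on_above_tangent_UNIV[OF Fm_neg(1,2), of "\<psi> x" "\<phi>_new x"]
      by (simp add: Fm_neg(3) \<delta>_def algebra_simps)
    ultimately show ?thesis by (simp add: F_split algebra_simps)
  qed
  then have "(\<integral>x. F (\<phi>_new x) - F (\<psi> x) \<partial>M) \<le> W"
    unfolding W_def M_def
    by (intro integral_mono int_bm[OF bounded_measurable_diff[OF F_bm]] int_bm[OF W_int])
  then have "(\<integral>x. F (\<phi>_new x) \<partial>M) - (\<integral>x. F (\<psi> x) \<partial>M) \<le> W"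
    using int_bm[OF F_bm(1)] int_bm[OF F_bm(2)] by (simp add: M_def)
  moreover have "\<sigma> * \<epsilon> / 2 * I2 + \<sigma> * \<epsilon> / 2 * I5 - \<sigma> * \<epsilon> / 2 * I9 + W - Z = 0"
    using interface by (simp add: algebra_simps add_divide_distrib diff_divide_distrib)
  \<comment> \<open>Adding \<open>kinetic\<close>, \<open>mass\<close> and the scaled potential
    identity removes \<open>X\<close> and \<open>Z\<close> and leaves \<open>\<tau> * Y\<close> as
    the work of gravity. All of these are equalities; the only loss is the replacement of
    \<open>W\<close> by the increment of the integral of \<open>F\<close>.\<close>
  ultimately show ?thesis using kinetic mass
    unfolding M_def[symmetric] \<psi>_def[symmetric] I1_def[symmetric] I2_def[symmetric] I4_def[symmetric]
      I5_def[symmetric] I6_def[symmetric] I7_def[symmetric] I8_def[symmetric] I9_def[symmetric] Y_def[symmetric]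
    by argo
qed

end
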